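(* Let $\alpha\in(0,1/2]$, let $$ \varepsilon_0^\alpha=\frac{\sqrt\alpha}{1-\alpha}\log(1/\alpha),\qquad K(\alpha,\varepsilon)=\frac{1-\alpha}{e^{\sqrt\alpha\,\varepsilon}-\alpha\, e^{\varepsilon/\sqrt\alpha}}, $$ and let $\varepsilon\in(0,\varepsilon_0^\alpha)$. If $\mathcal{T}$ is an $\alpha$-tree on a measure space $(X,\mu)$, $J\in\mathcal{T}$, and $\varphi\in\mathrm{BMO}(\mathcal{T})$ satisfies $\|\varphi\|_{\mathrm{BMO}(\mathcal{T})}\le\varepsilon$, then $$ \langle e^{\varphi}\rangle_{J,\mu}\le K(\alpha,\varepsilon)\,e^{\langle\varphi\rangle_{J,\mu}}. $$
   Context: Notation: $\langle\varphi\rangle_{J,\mu}=\frac1{\mu(J)}\int_J\varphi\,d\mu$; functions are real-valued. $\alpha$-tree: let $(X,\mu)$ be a measure space with $0<\mu(X)<\infty$ and $\alpha\in(0,1/2]$. A collection $\mathcal{T}$ of measurable subsets of $X$ is an $\alpha$-tree if: (1) $X\in\mathcal{T}$; (2) for every $J\in\mathcal{T}$ there is a subset $C(J)\subset\mathcal{T}$ (the children of $J$) such that $J=\bigcup_{I\in C(J)}I$, the elements of $C(J)$ are pairwise disjoint up to sets of measure zero, and $\mu(I)\ge\alpha\mu(J)$ for every $I\in C(J)$; (3) $\mathcal{T}=\bigcup_{m\ge0}\mathcal{T}_m$, where $\mathcal{T}_0=\{X\}$ and $\mathcal{T}_{m+1}=\bigcup_{J\in\mathcal{T}_m}C(J)$;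 (4) $\mathcal{T}$ differentiates $L^1(X,\mu)$, i.e. for every $f\in L^1(X,\mu)$, for $\mu$-a.e. $x$, the averages $\langle f\rangle_{J_m,\mu}$ over the elements $J_m\in\mathcal{T}_m$ containing $x$ converge to $f(x)$ as $m\to\infty$. BMO on the tree: $\varphi\in\mathrm{BMO}(\mathcal{T})$ iff $$\|\varphi\|_{\mathrm{BMO}(\mathcal{T})}:=\sup_{J\in\mathcal{T}}\big(\langle\varphi^2\rangle_{J,\mu}-\langle\varphi\rangle_{J,\mu}^2\big)^{1/2}<\infty$$ (in particular $\varphi\in L^2(X,\mu)$). *)

theory Defs
  imports "HOL-Analysis.Analysis"
begin

definition avg :: "'a measure \<Rightarrow> 'a set \<Rightarrow> ('a \<Rightarrow> real) \<Rightarrow> real" where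
  "avg M J f = (LINT x:J|M. f x) / measure M J"

primrec generation :: "'a set \<Rightarrow> ('a set \<Rightarrow> 'a set set) \<Rightarrow> nat \<Rightarrow> 'a set set" where
  "generation X C 0 = {X}"
| "generation X C (Suc m) = (\<Union>J\<in>generation X C m. C J)"

text \<open>In the last clause, distinct sets of the same generation may overlap in a null set, so the
  element of a given generation containing \<open>x\<close> is unique only for almost every \<open>x\<close>;
  convergence is therefore required along every choice \<open>J\<close> of such elements.\<close>

definition alpha_tree :: "real \<Rightarrow> 'a measure \<Rightarrow> 'a set set \<Rightarrow> bool" where
  "alpha_tree \<alpha> M T \<longleftrightarrow>
     T \<subseteq> sets M \<and>
     space M \<in> T \<and>
     (\<exists>C. (\<forall>J\<in>T. C J \<subseteq> T \<and> J = \<Union>(C J) \<and>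
                 (\<forall>I\<in>C J. \<forall>I'\<in>C J. I \<noteq> I' \<longrightarrow> emeasure M (I \<inter> I') = 0) \<and>
                 (\<forall>I\<in>C J. measure M I \<ge> \<alpha> * measure M J)) \<and>
          T = (\<Union>m. generation (space M) C m) \<and>
          (\<forall>f :: 'a \<Rightarrow> real. integrable M f \<longrightarrow>
             (AE x in M. \<forall>J. (\<forall>m. J m \<in> generation (space M) C m \<and> x \<in> J m) \<longrightarrow>
                (\<lambda>m. avg M (J m) f) \<longlonglongrightarrow> f x)))"

definition bmo_norm :: "'a measure \<Rightarrow> 'a set set \<Rightarrow> ('a \<Rightarrow> real) \<Rightarrow> ereal" where
  "bmo_norm M T \<phi> =
     (SUP J\<in>T. ereal (sqrt (avg M J (\<lambda>x. (\<phi> x)\<^sup>2) - (avg M J \<phi>)\<^sup>2)))"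

text \<open>Square integrability has to be required explicitly, because the integral of a
  non-integrable function is 0 by convention.\<close>

definition BMO :: "'a measure \<Rightarrow> 'a set set \<Rightarrow> ('a \<Rightarrow> real) set" where
  "BMO M T = {\<phi>. \<phi> \<in> borel_measurable M \<and> integrable M (\<lambda>x. (\<phi> x)\<^sup>2) \<and> bmo_norm M T \<phi> < \<infinity>}"

definition eps0 :: "real \<Rightarrow> real" where
  "eps0 \<alpha> = sqrt \<alpha> / (1 - \<alpha>) * ln (1 / \<alpha>)"

definition K_const :: "real \<Rightarrow> real \<Rightarrow> real" where
  "K_const \<alpha> \<epsilon> = (1 - \<alpha>) / (exp (sqrt \<alpha> * \<epsilon>) - \<alpha> * exp (\<epsilon> / sqrt \<alpha>))"

end

theory Submission
  imports Defs
begin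

text \<open>
  The Bellman function \<open>bell x t = e\<^sup>x F(sqrt (\<delta>\<^sup>2 - t)) / F(\<delta>)\<close> with
  \<open>F(r) = (1 - r) e\<^sup>r\<close>, in the mean \<open>x\<close> and the variance \<open>t\<close>, is the locally concave
  function that solves the integral John--Nirenberg problem for a BMO ball of radius \<open>\<delta>\<close>. Here
  \<open>\<delta> > \<epsilon>\<close> is chosen so that \<open>bell x \<epsilon>\<^sup>2 = K(\<alpha>, \<epsilon>) e\<^sup>x\<close>.
  For this \<open>\<delta>\<close> the function is concave along every splitting with weights at least
  \<open>\<alpha>\<close> and variances at most \<open>\<epsilon>\<^sup>2\<close>, even when the segment between the two points
  leaves the domain of \<open>bell\<close>; the extremal splitting puts weight \<open>\<alpha>\<close> on a point of variance
  \<open>\<epsilon>\<^sup>2\<close> and \<open>1 - \<alpha>\<close> on a point of variance \<open>0\<close>. Hence the mean of \<open>bell\<close> over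
  the tree does not increase from one generation to the next, and since \<open>e\<^sup>x \<le> bell x t\<close>,
  differentiation along the tree and Fatou's lemma give the bound.
\<close>

section \<open>The profile function\<close>

text \<open>This is F of the introduction. Its derivative \<open>- r * exp r\<close> puts its
  maximum at 0, with value 1.\<close>

definition xe :: "real \<Rightarrow> real" where
  "xe r = (1 - r) * exp r"

lemma xe_has_derivative [derivative_intros]:
  assumes "(f has_real_derivative f') (at x within S)"
  shows "((\<lambda>x. xe (f x)) has_real_derivative (- f x * exp (f x)) * f') (at x within S)"
  unfolding xe_def by (auto intro!: derivative_eq_intros assms simp: algebra_simps)

lemma continuous_on_xe [continuous_intros]:
  "continuous_on S f \<Longrightarrow> continuous_on S (\<lambda>x. xe (f x))"
  unfolding xe_def by (intro continuous_intros)

text \<open>With the square as the variable the factor \<open>sqrt s\<close> cancels, so derivatives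
  in the variance are plain exponentials.\<close>

lemma xe_sqrt_has_derivative:
  assumes "0 < s"
  shows "((\<lambda>s. xe (sqrt s)) has_real_derivative - exp (sqrt s) / 2) (at s)"
proof -
  have "(sqrt has_real_derivative inverse (sqrt s) / 2) (at s)"
    by (rule DERIV_real_sqrt[OF assms])
  from xe_has_derivative[OF this] show ?thesis using assms by (simp add: field_simps)
qed

lemma xe_antimono: "0 \<le> x \<Longrightarrow> x \<le> y \<Longrightarrow> xe y \<le> xe x"
  by (rule DERIV_nonpos_imp_nonincreasing[of x y xe])
     (auto intro!: exI derivative_eq_intros xe_has_derivative)

lemma xe_mono: "y \<le> 0 \<Longrightarrow> x \<le> y \<Longrightarrow> xe x \<le> xe y"
  by (rule DERIV_nonneg_imp_nondecreasing[of x y xe])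
     (auto intro!: exI derivative_eq_intros xe_has_derivative simp: mult_nonpos_nonneg)

lemma xe_le_1: "xe x \<le> 1"
  using xe_antimono[of 0 x] xe_mono[of 0 x] by (cases "x \<ge> 0") (auto simp: xe_def)

lemma xe_pos: "x < 1 \<Longrightarrow> 0 < xe x"
  by (simp add: xe_def)

section \<open>Tangent-plane defects and the concavity gap\<close>

text \<open>Up to a factor, the amount by which the tangent plane of \<open>bell\<close> at one point exceeds
  \<open>bell\<close> at another.\<close>

definition bend :: "real \<Rightarrow> real \<Rightarrow> real" where
  "bend z p = z\<^sup>2 / 2 - (1 - p) * (exp z - 1 - z)"

definition bend' :: "real \<Rightarrow> real \<Rightarrow> real" where
  "bend' z p = z - (1 - p) * (exp z - 1)"

lemma bend_has_derivative: "((\<lambda>z. bend z p) has_real_derivative bend' z p) (at z)"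
  unfolding bend_def bend'_def by (auto intro!: derivative_eq_intros simp: algebra_simps)

text \<open>The difference of the two sides vanishes to first order at 0 and has second derivative
  \<open>(1 - xe z) / 3\<close>, nonnegative by \<open>xe_le_1\<close>. The constant 3 makes the
  cubic terms at 0 cancel.\<close>

lemma exp_remainder_bound: "(1 - z / 3) * (exp z - 1 - z) \<le> z\<^sup>2 / (2::real)"
proof -
  define k where "k = (\<lambda>z::real. z\<^sup>2 / 2 - (1 - z / 3) * (exp z - 1 - z))"
  define k' where "k' = (\<lambda>z::real. z + (exp z - 1 - z) / 3 - (1 - z / 3) * (exp z - 1))"
  have k: "(k has_real_derivative k' x) (at x)" for x
    unfolding k_def k'_def
    by (auto intro!: derivative_eq_intros simp: algebra_simps diff_divide_distrib add_divide_distrib)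
  have k': "(k' has_real_derivative (1 - xe x) / 3) (at x)" for x
    unfolding k'_def xe_def
    by (auto intro!: derivative_eq_intros simp: algebra_simps diff_divide_distrib add_divide_distrib)
  have mono: "k' x \<le> k' y" if "x \<le> y" for x y
    by (rule DERIV_nonneg_imp_nondecreasing[OF that]) (use k' xe_le_1 in \<open>force intro!: exI\<close>)
  have "k' 0 = 0" "k 0 = 0" by (simp_all add: k'_def k_def)
  have "0 \<le> k z"
  proof (cases "0 \<le> z")
    case True
    have "k 0 \<le> k z"
      by (rule DERIV_nonneg_imp_nondecreasing[OF True]) (use k mono \<open>k' 0 = 0\<close> in \<open>metis\<close>)
    then show ?thesis using \<open>k 0 = 0\<close> by simp
  next
    case False
    have "k 0 \<le> k z"
      by (rule DERIV_nonpos_imp_nonincreasing[of z 0 k]) (use False k mono \<open>k' 0 = 0\<close> in \<open>auto, metis\<close>)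
    then show ?thesis using \<open>k 0 = 0\<close> by simp
  qed
  then show ?thesis by (simp add: k_def)
qed

lemma bend_nonneg:
  assumes "z \<le> 3 * p"
  shows "0 \<le> bend z p"
proof -
  have "(1 - p) * (exp z - 1 - z) \<le> (1 - z / 3) * (exp z - 1 - z)"
    using assms exp_ge_add_one_self[of z] by (intro mult_right_mono) linarith+
  with exp_remainder_bound[of z] show ?thesis unfolding bend_def by linarith
qed

text \<open>Replacing \<open>p\<close> by the smaller \<open>z\<close> lowers the value to
  \<open>1 - xe z\<close>.\<close>

lemma bend'_nonneg:
  assumes "0 \<le> z" "z \<le> p"
  shows "0 \<le> bend' z p"
proof -
  have "(1 - p) * (exp z - 1) \<le> (1 - z) * (exp z - 1)"
    using assms by (intro mult_right_mono) auto
  with xe_le_1[of z] show ?thesis by (simp add: bend'_def xe_def algebra_simps)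
qed

text \<open>\<^term>\<open>bend'\<close> is concave in \<open>z\<close> and vanishes at \<open>0\<close>, so once it is
  negative it stays negative.\<close>

lemma bend'_nonpos:
  assumes "p \<le> 1" "0 \<le> z" "z \<le> y" "bend z p < 0"
  shows "bend' y p \<le> 0"
proof (rule ccontr)
  assume "\<not> bend' y p \<le> 0"
  then have y: "0 < bend' y p" by simp
  have conv: "convex_on UNIV (exp :: real \<Rightarrow> real)"
    by (rule exp_convex)
  \<comment> \<open>The chord of \<open>exp\<close> from 0 to \<open>y\<close> gives
    \<open>bend' x p \<ge> t * bend' y p\<close>, so \<open>bend\<close> would not fall below its
    value 0 at 0.\<close>
  have "0 \<le> bend' x p" if x: "0 \<le> x" "x \<le> z" for x
  proof (cases "y = 0")
    case True then show ?thesis using y by (simp add: bend'_def)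
  next
    case False
    then have "0 < y" using assms by simp
    define t where "t = x / y"
    have t: "0 \<le> t" "t \<le> 1" "x = t * y" using x assms \<open>0 < y\<close> by (auto simp: t_def)
    have "exp ((1 - t) *\<^sub>R 0 + t *\<^sub>R y) \<le> (1 - t) * exp 0 + t * exp y"
      using t by (intro convex_onD[OF conv]) auto
    then have "exp x - 1 \<le> t * (exp y - 1)" using t by (simp add: algebra_simps)
    then have "(1 - p) * (exp x - 1) \<le> (1 - p) * (t * (exp y - 1))"
      using assms by (intro mult_left_mono) auto
    moreover have "t * bend' y p \<ge> 0" using t y by simp
    ultimately show ?thesis using t by (simp add: bend'_def algebra_simps)
  qed
  then have "bend 0 p \<le> bend z p"
    using assms by (intro DERIV_nonneg_imp_nondecreasing[of 0 z "\<lambda>z. bend z p"])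
      (auto intro!: exI bend_has_derivative)
  then show False using assms by (simp add: bend_def)
qed

text \<open>The concavity defect of \<open>F\<close> for a right point of weight \<open>w\<close> at distance \<open>D\<close> from
  the left one, the variances at the right point, the left point and their mean being
  \<open>\<delta>\<^sup>2 - p\<^sup>2\<close>, \<open>\<delta>\<^sup>2 - q\<^sup>2\<close> and \<open>\<delta>\<^sup>2 - r\<^sup>2\<close>.\<close>

definition gap :: "real \<Rightarrow> real \<Rightarrow> real \<Rightarrow> real \<Rightarrow> real \<Rightarrow> real" where
  "gap w D r p q = xe r - w * exp ((1 - w) * D) * xe p - (1 - w) * exp (- w * D) * xe q"

text \<open>Once \<open>exp r\<close> is factored out, the terms of \<open>bend\<close> without
  \<open>exp\<close> add up to \<open>1 - r\<close>; this is where the variance relation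
  enters.\<close>

lemma gap_eq_bend:
  assumes "r\<^sup>2 = w * p\<^sup>2 + (1 - w) * q\<^sup>2 - w * (1 - w) * D\<^sup>2"
  shows "gap w D r p q =
    exp r * (w * bend ((1 - w) * D + p - r) p + (1 - w) * bend (- w * D + q - r) q)"
proof -
  define z where "z = (1 - w) * D + p - r"
  define y where "y = - w * D + q - r"
  have e1: "exp ((1 - w) * D) * exp p = exp r * exp z" "exp (- w * D) * exp q = exp r * exp y"
    by (simp_all add: z_def y_def flip: exp_add)
  have "w * (z\<^sup>2 / 2 + (1 - p) * (1 + z)) + (1 - w) * (y\<^sup>2 / 2 + (1 - q) * (1 + y)) =
      1 - r + (r\<^sup>2 - (w * p\<^sup>2 + (1 - w) * q\<^sup>2 - w * (1 - w) * D\<^sup>2)) / 2"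
    unfolding z_def y_def by (simp add: field_simps power2_eq_square)
  also have "\<dots> = 1 - r" using assms by simp
  finally have "1 - r - w * (1 - p) * exp z - (1 - w) * (1 - q) * exp y = w * bend z p + (1 - w) * bend y q"
    by (simp add: bend_def algebra_simps)
  moreover have "gap w D r p q = exp r * (1 - r - w * (1 - p) * exp z - (1 - w) * (1 - q) * exp y)"
    unfolding gap_def xe_def using e1
    by (simp add: algebra_simps)
  ultimately show ?thesis by (simp add: z_def y_def)
qed

text \<open>Both \<open>bend\<close> terms fall under \<open>bend_nonneg\<close>: the left one since
  \<open>- w * D - r \<le> 0\<close>, the right one by the last hypothesis.\<close>

lemma gap_nonneg_near:
  assumes "r\<^sup>2 = w * p\<^sup>2 + (1 - w) * q\<^sup>2 - w * (1 - w) * D\<^sup>2"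
    and "0 \<le> w" "w \<le> 1" "0 \<le> D" "0 \<le> q" "0 \<le> r" "(1 - w) * D \<le> 2 * p + r"
  shows "0 \<le> gap w D r p q"
proof -
  have "0 \<le> w * D" using assms by simp
  then have "0 \<le> bend ((1 - w) * D + p - r) p" "0 \<le> bend (- w * D + q - r) q"
    using assms by (intro bend_nonneg; linarith)+
  then show ?thesis using assms by (simp add: gap_eq_bend)
qed

section \<open>The two-point inequality\<close>

text \<open>\<open>\<rho>\<close> is the value of \<open>sqrt (\<delta>\<^sup>2 - t)\<close> at the
  largest variance \<open>t = \<epsilon>\<^sup>2\<close>, and \<open>jump\<close> says that
  \<open>xe \<rho> / xe \<delta>\<close> is \<open>K_const \<alpha> \<epsilon>\<close>.\<close>

locale bellman =
  fixes \<alpha> \<epsilon> \<delta> \<rho> :: real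
  assumes \<alpha>: "0 < \<alpha>" "\<alpha> < 1"
    and \<epsilon>: "0 < \<epsilon>" and \<rho>: "0 < \<rho>" and \<delta>: "0 < \<delta>" "\<delta> < 1" "\<delta>\<^sup>2 = \<rho>\<^sup>2 + \<epsilon>\<^sup>2"
    and jump: "xe \<rho> * (exp (sqrt \<alpha> * \<epsilon>) - \<alpha> * exp (\<epsilon> / sqrt \<alpha>)) = (1 - \<alpha>) * xe \<delta>"
begin

lemma \<rho>_le_\<delta>: "\<rho> \<le> \<delta>"
  by (rule power2_le_imp_le) (use \<delta> \<epsilon> in auto)

lemma \<delta>_le: "\<delta> \<le> \<rho> + \<epsilon>"
  by (rule power2_le_imp_le) (use \<delta> \<rho> \<epsilon> in \<open>auto simp: power2_sum\<close>)

text \<open>Multiplied by \<open>exp (- \<alpha> * D)\<close>, \<open>jump\<close> becomes equality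
  for the extremal splitting: variance \<open>\<epsilon>\<^sup>2\<close> at the right point and in
  the mean, variance 0 at the left point.\<close>

lemma jump_gap: "gap \<alpha> (\<epsilon> / sqrt \<alpha>) \<rho> \<rho> \<delta> = 0"
proof -
  have a: "sqrt \<alpha> * \<epsilon> = \<alpha> * (\<epsilon> / sqrt \<alpha>)"
    using \<alpha> by (simp add: field_simps)
  define D where "D = \<epsilon> / sqrt \<alpha>"
  have "xe \<rho> * (exp (\<alpha> * D) - \<alpha> * exp D) * exp (- \<alpha> * D) = (1 - \<alpha>) * xe \<delta> * exp (- \<alpha> * D)"
    using jump unfolding a D_def by simp
  moreover have "exp (\<alpha> * D) * exp (- \<alpha> * D) = 1" "exp D * exp (- \<alpha> * D) = exp ((1 - \<alpha>) * D)"
    by (simp_all flip: exp_add add: algebra_simps)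
  moreover have "xe \<rho> * (exp (\<alpha> * D) - \<alpha> * exp D) * exp (- \<alpha> * D) =
    xe \<rho> * (exp (\<alpha> * D) * exp (- \<alpha> * D) - \<alpha> * (exp D * exp (- \<alpha> * D)))"
    by (simp only: algebra_simps)
  ultimately show ?thesis unfolding gap_def D_def[symmetric] by (simp add: algebra_simps)
qed

text \<open>As \<open>D\<close> grows the gap first increases and then decreases, and it vanishes at
  \<open>D = 0\<close> and at \<open>D = \<epsilon> / sqrt \<alpha>\<close>.\<close>

lemma gap_top_right:
  assumes "0 \<le> D" "D \<le> \<epsilon> / sqrt \<alpha>"
  shows "0 \<le> gap \<alpha> D \<rho> \<rho> (sqrt (\<rho>\<^sup>2 + \<alpha> * D\<^sup>2))"
proof (rule ccontr)
  define q where "q = (\<lambda>D. sqrt (\<rho>\<^sup>2 + \<alpha> * D\<^sup>2))"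
  define E where "E = (\<lambda>D. gap \<alpha> D \<rho> \<rho> (q D))"
  define D1 where "D1 = \<epsilon> / sqrt \<alpha>"
  assume "\<not> ?thesis"
  then have neg: "E D < 0" by (simp add: E_def q_def)
  have q0: "0 < \<rho>\<^sup>2 + \<alpha> * D\<^sup>2" for D using \<rho> \<alpha> by (simp add: add_pos_nonneg)
  have q2: "(q D)\<^sup>2 = \<rho>\<^sup>2 + \<alpha> * D\<^sup>2" "0 < q D" for D
    using q0[of D] by (simp_all add: q_def)
  have dq: "(q has_real_derivative \<alpha> * x / q x) (at x)" for x
    unfolding q_def using q0[of x]
    by (auto intro!: derivative_eq_intros simp: field_simps)
  have dE: "(E has_real_derivative \<alpha> * (1 - \<alpha>) * exp ((1 - \<alpha>) * x) * (xe (q x - x) - xe \<rho>)) (at x)" for x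
  proof -
    have e: "exp (- \<alpha> * x) * exp (q x) = exp ((1 - \<alpha>) * x) * exp (q x - x)"
      by (simp flip: exp_add add: algebra_simps)
    have "(E has_real_derivative - \<alpha> * (exp ((1 - \<alpha>) * x) * (1 - \<alpha>)) * xe \<rho> -
       ((1 - \<alpha>) * (exp (- \<alpha> * x) * - \<alpha>) * xe (q x) +
        (1 - \<alpha>) * exp (- \<alpha> * x) * ((- q x * exp (q x)) * (\<alpha> * x / q x)))) (at x)"
      unfolding E_def gap_def
      by (auto intro!: derivative_eq_intros dq simp: algebra_simps)
    moreover have "(- q x * exp (q x)) * (\<alpha> * x / q x) = - exp (q x) * \<alpha> * x"
      using q2(2)[of x] by (simp add: field_simps)
    moreover have "- \<alpha> * (exp ((1 - \<alpha>) * x) * (1 - \<alpha>)) * xe \<rho> -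
       ((1 - \<alpha>) * (exp (- \<alpha> * x) * - \<alpha>) * xe (q x) +
        (1 - \<alpha>) * exp (- \<alpha> * x) * (- exp (q x) * \<alpha> * x)) =
       \<alpha> * (1 - \<alpha>) * ((exp (- \<alpha> * x) * exp (q x)) * (1 - q x + x) - exp ((1 - \<alpha>) * x) * xe \<rho>)"
      by (simp add: xe_def[of "q x"] algebra_simps)
    moreover have "\<dots> = \<alpha> * (1 - \<alpha>) * exp ((1 - \<alpha>) * x) * (xe (q x - x) - xe \<rho>)"
      unfolding e by (simp add: xe_def[of "q x - x"] algebra_simps)
    ultimately show ?thesis by (simp only:)
  qed
  have E0: "E 0 = 0" using \<rho> by (simp add: E_def q_def gap_def algebra_simps)
  have "q D1 = \<delta>" using \<alpha> \<delta> by (simp add: q_def D1_def power_divide flip: \<delta>(3))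
  then have E1: "E D1 = 0" using jump_gap by (simp add: E_def D1_def)
  have "0 < D" "D < D1" using assms neg E0 E1 by (auto simp: D1_def order_less_le)
  have decr: "q y - y \<le> q x - x" if "0 \<le> x" "x \<le> y" for x y
  proof -
    have "\<alpha> * x \<le> q x"
    proof (rule power2_le_imp_le)
      have "\<alpha> * \<alpha> * x\<^sup>2 \<le> \<alpha> * x\<^sup>2" using \<alpha> by (intro mult_right_mono) (auto simp: mult_left_le)
      then show "(\<alpha> * x)\<^sup>2 \<le> (q x)\<^sup>2"
        unfolding q2 power_mult_distrib by (simp add: power2_eq_square[of \<alpha>] add_increasing)
    qed (use q2(2) less_imp_le in auto)
    then have "(y - x) * (2 * (\<alpha> * x)) \<le> (y - x) * (2 * q x)"
      using that by (intro mult_left_mono) auto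
    moreover have "\<alpha> * (y - x)\<^sup>2 \<le> (y - x)\<^sup>2" using \<alpha> by (simp add: mult_left_le_one_le)
    ultimately have "(q y)\<^sup>2 \<le> (q x + (y - x))\<^sup>2"
      unfolding q2 power2_sum[of "q x"] by (simp add: q2 power2_eq_square algebra_simps)
    then have "q y \<le> q x + (y - x)"
      by (rule power2_le_imp_le) (use q2(2)[of x] that in auto)
    then show ?thesis by simp
  qed
  \<comment> \<open>A negative value between the two zeros of \<open>E\<close> yields a negative
    slope at \<open>c < D\<close> and a positive one at \<open>d > D\<close>. The first forces
    \<open>q c - c < 0\<close>; from there on \<open>xe (q x - x)\<close> cannot increase, against
    the second.\<close>
  obtain c where c: "0 < c" "c < D" "E D - E 0 = (D - 0) * (\<alpha> * (1 - \<alpha>) * exp ((1 - \<alpha>) * c) * (xe (q c - c) - xe \<rho>))"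
    using MVT2[OF \<open>0 < D\<close>, of E "\<lambda>x. \<alpha> * (1 - \<alpha>) * exp ((1 - \<alpha>) * x) * (xe (q x - x) - xe \<rho>)"] dE by blast
  obtain d where d: "D < d" "d < D1" "E D1 - E D = (D1 - D) * (\<alpha> * (1 - \<alpha>) * exp ((1 - \<alpha>) * d) * (xe (q d - d) - xe \<rho>))"
    using MVT2[OF \<open>D < D1\<close>, of E "\<lambda>x. \<alpha> * (1 - \<alpha>) * exp ((1 - \<alpha>) * x) * (xe (q x - x) - xe \<rho>)"] dE by blast
  have "0 < \<alpha> * (1 - \<alpha>) * exp ((1 - \<alpha>) * x)" for x using \<alpha> by simp
  moreover have "(D - 0) * (\<alpha> * (1 - \<alpha>) * exp ((1 - \<alpha>) * c) * (xe (q c - c) - xe \<rho>)) < 0"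
    and "0 < (D1 - D) * (\<alpha> * (1 - \<alpha>) * exp ((1 - \<alpha>) * d) * (xe (q d - d) - xe \<rho>))"
    unfolding c(3)[symmetric] d(3)[symmetric] using neg E0 E1 by simp_all
  ultimately have "xe (q c - c) < xe \<rho>" "xe \<rho> < xe (q d - d)"
    using \<open>0 < D\<close> \<open>D < D1\<close> \<alpha> by (auto simp: mult_less_0_iff zero_less_mult_iff)
  have "q c - c \<le> \<rho>" using decr[of 0 c] c \<rho> by (simp add: q_def)
  then have "q c - c < 0" using \<open>xe (q c - c) < xe \<rho>\<close> xe_antimono[of "q c - c" \<rho>] by linarith
  moreover have "q d - d \<le> q c - c" using decr[of c d] c d by simp
  ultimately have "xe (q d - d) \<le> xe (q c - c)" by (intro xe_mono) auto
  with \<open>xe (q c - c) < xe \<rho>\<close> \<open>xe \<rho> < xe (q d - d)\<close> show False by simp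
qed

text \<open>The left point has variance 0 and \<open>p\<close> is what the variance relation leaves.
  The gap starts from 0 by \<open>jump_gap\<close>, and its derivative has the sign of
  \<open>xe \<delta> - xe (p + D)\<close>, where
  \<open>p + D \<ge> \<rho> + \<epsilon> \<ge> \<delta>\<close>.\<close>

lemma gap_top_bottom:
  assumes "\<epsilon> / sqrt \<alpha> \<le> D"
  shows "0 \<le> gap \<alpha> D \<rho> (sqrt (\<delta>\<^sup>2 - \<epsilon>\<^sup>2 / \<alpha> + (1 - \<alpha>) * D\<^sup>2)) \<delta>"
proof -
  define p where "p = (\<lambda>D. sqrt (\<delta>\<^sup>2 - \<epsilon>\<^sup>2 / \<alpha> + (1 - \<alpha>) * D\<^sup>2))"
  define E where "E = (\<lambda>D. gap \<alpha> D \<rho> (p D) \<delta>)"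
  define D1 where "D1 = \<epsilon> / sqrt \<alpha>"
  have D1: "D1\<^sup>2 = \<epsilon>\<^sup>2 / \<alpha>" "0 < D1" using \<alpha> \<epsilon> by (simp_all add: D1_def power_divide)
  have "\<epsilon> \<le> D1" unfolding D1_def using \<alpha> \<epsilon> by (simp add: field_simps)
  have ge: "\<rho>\<^sup>2 \<le> \<delta>\<^sup>2 - \<epsilon>\<^sup>2 / \<alpha> + (1 - \<alpha>) * x\<^sup>2" if "D1 \<le> x" for x
  proof -
    have "D1\<^sup>2 \<le> x\<^sup>2" using that D1(2) by (intro power_mono) auto
    then have "(1 - \<alpha>) * (\<epsilon>\<^sup>2 / \<alpha>) \<le> (1 - \<alpha>) * x\<^sup>2"
      using \<alpha> unfolding D1 by (intro mult_left_mono) auto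
    moreover have "(1 - \<alpha>) * (\<epsilon>\<^sup>2 / \<alpha>) = \<epsilon>\<^sup>2 / \<alpha> - \<epsilon>\<^sup>2" using \<alpha> by (simp add: field_simps)
    ultimately show ?thesis using \<delta> by simp
  qed
  have p\<rho>: "\<rho> \<le> p x" if "D1 \<le> x" for x
    unfolding p_def using ge[OF that] \<rho> by (intro real_le_rsqrt)
  have dp: "(p has_real_derivative (1 - \<alpha>) * x / p x) (at x)" if "D1 \<le> x" for x
  proof -
    have "0 < \<delta>\<^sup>2 - \<epsilon>\<^sup>2 / \<alpha> + (1 - \<alpha>) * x\<^sup>2"
      using ge[OF that] \<rho> by (simp add: order_less_le_trans[of 0 "\<rho>\<^sup>2"])
    then show ?thesis
      unfolding p_def by (auto intro!: derivative_eq_intros simp: field_simps)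
  qed
  have dE: "(E has_real_derivative \<alpha> * (1 - \<alpha>) * exp (- \<alpha> * x) * (xe \<delta> - xe (p x + x))) (at x)"
    if "D1 \<le> x" for x
  proof -
    have e: "exp ((1 - \<alpha>) * x) * exp (p x) = exp (- \<alpha> * x) * exp (p x + x)"
      by (simp flip: exp_add add: algebra_simps)
    have "(E has_real_derivative - (\<alpha> * (exp ((1 - \<alpha>) * x) * (1 - \<alpha>)) * xe (p x) +
        \<alpha> * exp ((1 - \<alpha>) * x) * ((- p x * exp (p x)) * ((1 - \<alpha>) * x / p x))) -
       (1 - \<alpha>) * (exp (- \<alpha> * x) * - \<alpha>) * xe \<delta>) (at x)"
      unfolding E_def gap_def
      by (auto intro!: derivative_eq_intros dp[OF that] simp: algebra_simps)
    moreover have "(- p x * exp (p x)) * ((1 - \<alpha>) * x / p x) = - exp (p x) * (1 - \<alpha>) * x"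
      using p\<rho>[OF that] \<rho> by (simp add: field_simps)
    moreover have "- (\<alpha> * (exp ((1 - \<alpha>) * x) * (1 - \<alpha>)) * xe (p x) +
        \<alpha> * exp ((1 - \<alpha>) * x) * (- exp (p x) * (1 - \<alpha>) * x)) -
       (1 - \<alpha>) * (exp (- \<alpha> * x) * - \<alpha>) * xe \<delta> =
       \<alpha> * (1 - \<alpha>) * ((exp ((1 - \<alpha>) * x) * exp (p x)) * (p x - 1 + x) + exp (- \<alpha> * x) * xe \<delta>)"
      by (simp add: xe_def[of "p x"] algebra_simps)
    moreover have "\<dots> = \<alpha> * (1 - \<alpha>) * exp (- \<alpha> * x) * (xe \<delta> - xe (p x + x))"
      unfolding e xe_def[of "p x + x"] by (simp add: algebra_simps)
    ultimately show ?thesis by (simp only:)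
  qed
  have "E D1 \<le> E D"
  proof (rule DERIV_nonneg_imp_nondecreasing[of D1 D E])
    fix x assume x: "D1 \<le> x" "x \<le> D"
    have "xe (p x + x) \<le> xe \<delta>"
      using x p\<rho>[OF x(1)] \<delta>_le \<open>\<epsilon> \<le> D1\<close> \<delta>(1) by (intro xe_antimono) auto
    then show "\<exists>y. (E has_real_derivative y) (at x) \<and> 0 \<le> y"
      using dE[OF x(1)] \<alpha> by (intro exI conjI) auto
  qed (use assms in \<open>simp add: D1_def\<close>)
  moreover have "\<delta>\<^sup>2 - \<epsilon>\<^sup>2 / \<alpha> + (1 - \<alpha>) * D1\<^sup>2 = \<rho>\<^sup>2"
    unfolding D1 \<delta>(3) using \<alpha> by (simp add: field_simps)
  then have "p D1 = \<rho>" using \<rho> by (simp add: p_def)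
  then have "E D1 = 0" using jump_gap by (simp add: E_def D1_def)
  ultimately show ?thesis by (simp add: E_def p_def)
qed

text \<open>For fixed \<open>D\<close> the gap increases with \<open>p\<close>, so \<open>p\<close> is lowered until
  \<open>p = \<rho>\<close> or \<open>q = \<delta>\<close>.\<close>

lemma gap_top:
  assumes "0 \<le> D" "\<rho> \<le> p" "\<rho> \<le> q" "q \<le> \<delta>"
    and eq: "\<rho>\<^sup>2 = \<alpha> * p\<^sup>2 + (1 - \<alpha>) * q\<^sup>2 - \<alpha> * (1 - \<alpha>) * D\<^sup>2"
  shows "0 \<le> gap \<alpha> D \<rho> p q"
proof -
  \<comment> \<open>The variable \<open>s\<close> stands for \<open>p\<^sup>2\<close>,
    \<open>Q s\<close> is the value of \<open>q\<^sup>2\<close> that the variance relation then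
    forces, and \<open>m\<close> is the least \<open>s\<close> with
    \<open>\<rho>\<^sup>2 \<le> s\<close> and \<open>Q s \<le> \<delta>\<^sup>2\<close>.\<close>
  define Q where "Q = (\<lambda>s. (\<rho>\<^sup>2 + \<alpha> * (1 - \<alpha>) * D\<^sup>2 - \<alpha> * s) / (1 - \<alpha>))"
  define E where "E = (\<lambda>s. gap \<alpha> D \<rho> (sqrt s) (sqrt (Q s)))"
  define m where "m = max (\<rho>\<^sup>2) ((\<rho>\<^sup>2 + \<alpha> * (1 - \<alpha>) * D\<^sup>2 - (1 - \<alpha>) * \<delta>\<^sup>2) / \<alpha>)"
  have "Q (p\<^sup>2) = ((1 - \<alpha>) * q\<^sup>2) / (1 - \<alpha>)" unfolding Q_def using eq by (simp add: algebra_simps)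
  then have Qp: "Q (p\<^sup>2) = q\<^sup>2" using \<alpha> by simp
  have qd: "q\<^sup>2 \<le> \<delta>\<^sup>2" "\<rho>\<^sup>2 \<le> p\<^sup>2" "\<rho>\<^sup>2 \<le> q\<^sup>2" using assms(2-4) \<rho> by (auto intro!: power_mono)
  then have "(1 - \<alpha>) * q\<^sup>2 \<le> (1 - \<alpha>) * \<delta>\<^sup>2" using \<alpha> by (intro mult_left_mono) auto
  then have mp: "m \<le> p\<^sup>2" using qd eq \<alpha> by (simp add: m_def field_simps)
  have "E m \<le> E (p\<^sup>2)"
  proof (rule DERIV_nonneg_imp_nondecreasing[of m "p\<^sup>2" E, OF mp])
    fix s assume s: "m \<le> s" "s \<le> p\<^sup>2"
    have s\<rho>: "\<rho>\<^sup>2 \<le> s" using s by (simp add: m_def)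
    then have s0: "0 < s" "\<rho> \<le> sqrt s" using \<rho> by (auto intro: real_le_rsqrt simp: order_less_le_trans[of 0 "\<rho>\<^sup>2"])
    have "Q (p\<^sup>2) \<le> Q s" using s \<alpha> by (simp add: Q_def divide_right_mono mult_left_mono)
    then have Q0: "0 < Q s" using Qp qd \<rho> by (smt (verit) zero_less_power)
    \<comment> \<open>The sign of the derivative of \<open>E\<close> comes down to
      \<open>sqrt (Q s) \<le> D + sqrt s\<close>.\<close>
    have "Q s \<le> (\<rho>\<^sup>2 + \<alpha> * (1 - \<alpha>) * D\<^sup>2 - \<alpha> * \<rho>\<^sup>2) / (1 - \<alpha>)"
      using s\<rho> \<alpha> by (simp add: Q_def divide_right_mono mult_left_mono)
    also have "\<dots> = \<rho>\<^sup>2 + \<alpha> * D\<^sup>2" using \<alpha> by (simp add: field_simps)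
    also have "\<dots> \<le> s + D\<^sup>2" using s\<rho> \<alpha> by (intro add_mono) (auto simp: mult_left_le_one_le)
    also have "\<dots> \<le> (D + sqrt s)\<^sup>2" using s0 assms by (simp add: power2_sum)
    finally have "sqrt (Q s) \<le> D + sqrt s" using s0 assms by (intro real_le_lsqrt) auto
    then have le: "exp (- \<alpha> * D) * exp (sqrt (Q s)) \<le> exp ((1 - \<alpha>) * D) * exp (sqrt s)"
      by (simp flip: exp_add add: algebra_simps)
    have "(Q has_real_derivative - \<alpha> / (1 - \<alpha>)) (at s)"
      unfolding Q_def using \<alpha> by (auto intro!: derivative_eq_intros)
    note dQ = DERIV_chain2[OF xe_sqrt_has_derivative[OF Q0] this]
    have "(E has_real_derivative 0 - \<alpha> * exp ((1 - \<alpha>) * D) * (- exp (sqrt s) / 2) -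
        (1 - \<alpha>) * exp (- \<alpha> * D) * (- exp (sqrt (Q s)) / 2 * (- \<alpha> / (1 - \<alpha>)))) (at s)"
      unfolding E_def gap_def
      by (intro DERIV_diff DERIV_const DERIV_cmult dQ xe_sqrt_has_derivative s0)
    moreover have "0 - \<alpha> * exp ((1 - \<alpha>) * D) * (- exp (sqrt s) / 2) -
        (1 - \<alpha>) * exp (- \<alpha> * D) * (- exp (sqrt (Q s)) / 2 * (- \<alpha> / (1 - \<alpha>))) =
      \<alpha> / 2 * (exp ((1 - \<alpha>) * D) * exp (sqrt s) - exp (- \<alpha> * D) * exp (sqrt (Q s)))"
      using \<alpha> by (simp add: field_simps)
    ultimately have "(E has_real_derivative
      \<alpha> / 2 * (exp ((1 - \<alpha>) * D) * exp (sqrt s) - exp (- \<alpha> * D) * exp (sqrt (Q s)))) (at s)"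
      by (simp only:)
    then show "\<exists>y. (E has_real_derivative y) (at s) \<and> 0 \<le> y"
      using le \<alpha> by (intro exI conjI) auto
  qed
  moreover have "E (p\<^sup>2) = gap \<alpha> D \<rho> p q" using assms \<rho> Qp by (simp add: E_def)
  moreover have "0 \<le> E m"
  \<comment> \<open>At \<open>D = \<epsilon> / sqrt \<alpha>\<close> both constraints bind; for
    smaller \<open>D\<close> lowering \<open>p\<close> first meets \<open>p = \<rho>\<close>, for
    larger \<open>D\<close> it first meets \<open>q = \<delta>\<close>.\<close>
  proof (cases "D \<le> \<epsilon> / sqrt \<alpha>")
    case True
    then have "D\<^sup>2 \<le> (\<epsilon> / sqrt \<alpha>)\<^sup>2" using assms by (intro power_mono) auto
    then have le: "\<alpha> * D\<^sup>2 \<le> \<epsilon>\<^sup>2" using \<alpha> by (simp add: power_divide field_simps)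
    then have "(1 - \<alpha>) * (\<alpha> * D\<^sup>2) \<le> (1 - \<alpha>) * \<epsilon>\<^sup>2" using \<alpha> by (intro mult_left_mono) auto
    then have "\<rho>\<^sup>2 + \<alpha> * (1 - \<alpha>) * D\<^sup>2 - (1 - \<alpha>) * \<delta>\<^sup>2 \<le> \<rho>\<^sup>2 * \<alpha>"
      unfolding \<delta>(3) by (simp add: algebra_simps)
    then have "m = \<rho>\<^sup>2" using \<alpha> by (simp add: m_def divide_le_eq)
    moreover have "Q (\<rho>\<^sup>2) = \<rho>\<^sup>2 + \<alpha> * D\<^sup>2" using \<alpha> by (simp add: Q_def field_simps)
    ultimately show ?thesis using gap_top_right[OF assms(1) True] \<rho> by (simp add: E_def)
  next
    case False
    then have "(\<epsilon> / sqrt \<alpha>)\<^sup>2 \<le> D\<^sup>2" using \<alpha> \<epsilon> by (intro power_mono) auto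
    then have le: "\<epsilon>\<^sup>2 \<le> \<alpha> * D\<^sup>2" using \<alpha> by (simp add: power_divide field_simps)
    then have "(1 - \<alpha>) * \<epsilon>\<^sup>2 \<le> (1 - \<alpha>) * (\<alpha> * D\<^sup>2)" using \<alpha> by (intro mult_left_mono) auto
    then have "\<rho>\<^sup>2 * \<alpha> \<le> \<rho>\<^sup>2 + \<alpha> * (1 - \<alpha>) * D\<^sup>2 - (1 - \<alpha>) * \<delta>\<^sup>2"
      unfolding \<delta>(3) by (simp add: algebra_simps)
    then have m: "m = (\<rho>\<^sup>2 + \<alpha> * (1 - \<alpha>) * D\<^sup>2 - (1 - \<alpha>) * \<delta>\<^sup>2) / \<alpha>"
      using \<alpha> by (simp add: m_def le_divide_eq)
    then have "Q m = \<delta>\<^sup>2" using \<alpha> by (simp add: Q_def)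
    moreover have "m = \<delta>\<^sup>2 - \<epsilon>\<^sup>2 / \<alpha> + (1 - \<alpha>) * D\<^sup>2"
      unfolding m \<delta>(3) using \<alpha> by (simp add: field_simps)
    ultimately show ?thesis using gap_top_bottom[of D] False \<delta>(1) by (simp add: E_def)
  qed
  ultimately show ?thesis by simp
qed

text \<open>Where the gap could be negative, it decreases in \<open>D\<close>; increasing \<open>D\<close> until
  the midpoint is as low as \<open>\<rho>\<close> reduces to \<open>gap_top\<close>.\<close>

lemma gap_min_weight:
  assumes "0 \<le> D" "\<rho> \<le> p" "p \<le> \<delta>" "\<rho> \<le> q" "q \<le> \<delta>" "\<rho> \<le> r"
    and eq: "r\<^sup>2 = \<alpha> * p\<^sup>2 + (1 - \<alpha>) * q\<^sup>2 - \<alpha> * (1 - \<alpha>) * D\<^sup>2"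
  shows "0 \<le> gap \<alpha> D r p q"
proof (rule ccontr)
  assume neg: "\<not> 0 \<le> gap \<alpha> D r p q"
  \<comment> \<open>\<open>R x\<close> is the value of \<open>r\<close> forced by the distance
    \<open>x\<close>; at \<open>Ds\<close> it has dropped to \<open>\<rho>\<close>.\<close>
  define C where "C = \<alpha> * p\<^sup>2 + (1 - \<alpha>) * q\<^sup>2"
  define R where "R = (\<lambda>x. sqrt (C - \<alpha> * (1 - \<alpha>) * x\<^sup>2))"
  define E where "E = (\<lambda>x. gap \<alpha> x (R x) p q)"
  define Ds where "Ds = sqrt ((C - \<rho>\<^sup>2) / (\<alpha> * (1 - \<alpha>)))"
  have c: "0 < \<alpha> * (1 - \<alpha>)" using \<alpha> by simp
  have rho2: "\<rho>\<^sup>2 \<le> r\<^sup>2" using assms \<rho> by (intro power_mono) auto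
  have RD: "R D = r" using eq assms(6) \<rho> unfolding R_def C_def by (metis abs_of_nonneg less_imp_le order_less_le_trans real_sqrt_abs)
  have "D\<^sup>2 = (C - r\<^sup>2) / (\<alpha> * (1 - \<alpha>))" using eq \<alpha> by (simp add: C_def)
  then have D2: "D\<^sup>2 \<le> (C - \<rho>\<^sup>2) / (\<alpha> * (1 - \<alpha>))" using rho2 c by (simp add: divide_right_mono)
  then have DDs: "D \<le> Ds" unfolding Ds_def by (rule real_le_rsqrt)
  have Ds2: "Ds\<^sup>2 = (C - \<rho>\<^sup>2) / (\<alpha> * (1 - \<alpha>))"
    unfolding Ds_def using D2 order_trans[OF zero_le_power2] by (intro real_sqrt_pow2) blast
  have RDs2: "C - \<alpha> * (1 - \<alpha>) * Ds\<^sup>2 = \<rho>\<^sup>2" unfolding Ds2 using \<alpha> by simp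
  have RDs: "R Ds = \<rho>" unfolding R_def RDs2 using \<rho> by simp
  have R2: "\<rho>\<^sup>2 \<le> C - \<alpha> * (1 - \<alpha>) * x\<^sup>2" if "D \<le> x" "x \<le> Ds" for x
  proof -
    have "x\<^sup>2 \<le> Ds\<^sup>2" using that assms by (intro power_mono) auto
    then have "\<alpha> * (1 - \<alpha>) * x\<^sup>2 \<le> \<alpha> * (1 - \<alpha>) * Ds\<^sup>2" using c by (intro mult_left_mono) auto
    then show ?thesis using RDs2 by linarith
  qed
  \<comment> \<open>Near points have a nonnegative gap, so the points are far apart. The left
    \<open>bend\<close> is nonnegative, so the right one must be negative.\<close>
  have far: "2 * p + r < (1 - \<alpha>) * D"
    using neg gap_nonneg_near[OF eq] assms \<alpha> \<rho> by force
  have "0 \<le> \<alpha> * D" using assms \<alpha> by simp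
  then have "0 \<le> bend (- \<alpha> * D + q - r) q" using assms \<rho> by (intro bend_nonneg) linarith
  moreover have "exp r * (\<alpha> * bend ((1 - \<alpha>) * D + p - r) p + (1 - \<alpha>) * bend (- \<alpha> * D + q - r) q) < 0"
    using neg gap_eq_bend[OF eq] by simp
  then have "\<alpha> * bend ((1 - \<alpha>) * D + p - r) p + (1 - \<alpha>) * bend (- \<alpha> * D + q - r) q < 0"
    by (simp add: mult_less_0_iff not_less[symmetric])
  ultimately have "\<alpha> * bend ((1 - \<alpha>) * D + p - r) p < 0"
    using \<alpha> mult_nonneg_nonneg[of "1 - \<alpha>" "bend (- \<alpha> * D + q - r) q"] by linarith
  then have bneg: "bend ((1 - \<alpha>) * D + p - r) p < 0"
    using \<alpha> by (simp add: mult_less_0_iff)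
  have "E Ds \<le> E D"
  proof (rule DERIV_nonpos_imp_nonincreasing[OF DDs])
    fix x assume x: "D \<le> x" "x \<le> Ds"
    define z where "z = (1 - \<alpha>) * x + p - R x"
    define y where "y = - \<alpha> * x + q - R x"
    have Rpos: "0 < C - \<alpha> * (1 - \<alpha>) * x\<^sup>2" using R2[OF x] zero_less_power[OF \<rho>, of 2] by linarith
    then have Rx: "0 < R x" "(R x)\<^sup>2 = \<alpha> * p\<^sup>2 + (1 - \<alpha>) * q\<^sup>2 - \<alpha> * (1 - \<alpha>) * x\<^sup>2"
      by (simp_all add: R_def C_def)
    have "D\<^sup>2 \<le> x\<^sup>2" using x assms by (intro power_mono) auto
    then have "\<alpha> * (1 - \<alpha>) * D\<^sup>2 \<le> \<alpha> * (1 - \<alpha>) * x\<^sup>2" using c by (intro mult_left_mono) auto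
    then have "R x \<le> R D" by (simp add: R_def)
    then have Rr: "R x \<le> r" using RD by simp
    have ax: "(1 - \<alpha>) * D \<le> (1 - \<alpha>) * x" using x \<alpha> by (intro mult_left_mono) auto
    have e: "exp ((1 - \<alpha>) * x) * exp p = exp (R x) * exp z" "exp (- \<alpha> * x) * exp q = exp (R x) * exp y"
      by (simp_all add: z_def y_def flip: exp_add)
    have dR: "(R has_real_derivative - \<alpha> * (1 - \<alpha>) * x / R x) (at x)"
      unfolding R_def using Rpos by (auto intro!: derivative_eq_intros simp: field_simps)
    have "(E has_real_derivative (- R x * exp (R x)) * (- \<alpha> * (1 - \<alpha>) * x / R x)
       - \<alpha> * (exp ((1 - \<alpha>) * x) * (1 - \<alpha>)) * xe p - (1 - \<alpha>) * (exp (- \<alpha> * x) * - \<alpha>) * xe q) (at x)"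
      unfolding E_def gap_def
      by (auto intro!: derivative_eq_intros dR simp: algebra_simps)
    moreover have "(- R x * exp (R x)) * (- \<alpha> * (1 - \<alpha>) * x / R x) = exp (R x) * \<alpha> * (1 - \<alpha>) * x"
      using Rx by simp
    moreover have "exp (R x) * \<alpha> * (1 - \<alpha>) * x
       - \<alpha> * (exp ((1 - \<alpha>) * x) * (1 - \<alpha>)) * xe p - (1 - \<alpha>) * (exp (- \<alpha> * x) * - \<alpha>) * xe q =
       \<alpha> * (1 - \<alpha>) * (exp (R x) * x - (1 - p) * (exp ((1 - \<alpha>) * x) * exp p) + (1 - q) * (exp (- \<alpha> * x) * exp q))"
      by (simp add: xe_def algebra_simps)
    moreover have "\<dots> = \<alpha> * (1 - \<alpha>) * (exp (R x) * (x - (1 - p) * exp z + (1 - q) * exp y))"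
      unfolding e by (simp add: algebra_simps)
    moreover have "x - (1 - p) * exp z + (1 - q) * exp y = bend' z p - bend' y q"
    proof -
      have "x = z - y - p + q" by (simp add: z_def y_def algebra_simps)
      then show ?thesis by (simp add: bend'_def algebra_simps)
    qed
    ultimately have dE: "(E has_real_derivative \<alpha> * (1 - \<alpha>) * (exp (R x) * (bend' z p - bend' y q))) (at x)"
      by (simp only:)
    \<comment> \<open>The argument \<open>z\<close> has only grown since \<open>D\<close>, where
      \<open>bend\<close> was already negative.\<close>
    have "bend' z p \<le> 0"
      by (rule bend'_nonpos[OF _ _ _ bneg]) (use assms \<rho> \<delta> far ax Rr in \<open>auto simp: z_def\<close>)
    moreover have "0 \<le> bend' y q"
    proof (rule bend'_nonneg)
      have "\<alpha> * x \<ge> 0" using x assms \<alpha> by simp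
      then show "y \<le> q" using Rx(1) by (simp add: y_def)
      \<comment> \<open>Being far apart gives \<open>p < (1 - \<alpha>) * x - R x\<close>, which the
        variance relation turns into \<open>R x + \<alpha> * x \<le> q\<close>.\<close>
      have "p < (1 - \<alpha>) * x - R x" using far ax Rr assms \<rho> by linarith
      then have "p\<^sup>2 \<le> ((1 - \<alpha>) * x - R x)\<^sup>2" using assms \<rho> by (intro power_mono) auto
      then have "0 \<le> \<alpha> * (((1 - \<alpha>) * x - R x)\<^sup>2 - p\<^sup>2)" using \<alpha> by simp
      also have "\<dots> = (1 - \<alpha>) * (q\<^sup>2 - (R x + \<alpha> * x)\<^sup>2) +
          ((R x)\<^sup>2 - (\<alpha> * p\<^sup>2 + (1 - \<alpha>) * q\<^sup>2 - \<alpha> * (1 - \<alpha>) * x\<^sup>2))"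
        by (simp add: power2_eq_square algebra_simps)
      also have "\<dots> = (1 - \<alpha>) * (q\<^sup>2 - (R x + \<alpha> * x)\<^sup>2)" using Rx by simp
      finally have "(R x + \<alpha> * x)\<^sup>2 \<le> q\<^sup>2" using \<alpha> by (simp add: zero_le_mult_iff)
      then have "R x + \<alpha> * x \<le> q" by (rule power2_le_imp_le) (use assms \<rho> in auto)
      then show "0 \<le> y" by (simp add: y_def)
    qed
    ultimately have "\<alpha> * (1 - \<alpha>) * (exp (R x) * (bend' z p - bend' y q)) \<le> 0"
      using c by (intro mult_nonneg_nonpos) auto
    with dE show "\<exists>y. (E has_real_derivative y) (at x) \<and> y \<le> 0" by blast
  qed
  moreover have "0 \<le> E Ds"
    unfolding E_def RDs using assms RDs2 DDs by (intro gap_top) (auto simp: C_def)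
  ultimately show False using neg RD by (simp add: E_def)
qed

text \<open>The left point is moved towards the midpoint until the right one carries weight
  \<open>\<alpha>\<close>; the loss is controlled by \<open>gap_nonneg_near\<close>.\<close>

lemma gap_nonneg_right:
  assumes "0 \<le> D" "\<rho> \<le> p" "p \<le> \<delta>" "\<rho> \<le> q" "q \<le> \<delta>" "\<rho> \<le> r"
    and w: "\<alpha> \<le> w" "w < 1"
    and eq: "r\<^sup>2 = w * p\<^sup>2 + (1 - w) * q\<^sup>2 - w * (1 - w) * D\<^sup>2"
  shows "0 \<le> gap w D r p q"
proof (cases "(1 - w) * D \<le> 2 * p + r")
  case True
  show ?thesis using assms \<alpha> \<rho> True by (intro gap_nonneg_near[OF eq]) auto
next
  case False
  \<comment> \<open>The left point, at distance \<open>w * D\<close> from the mean, is moved to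
    distance \<open>d\<close>, where with weight \<open>1 - \<alpha>\<close> it balances the right
    point with weight \<open>\<alpha>\<close>. The moved point mixes the midpoint, with weight
    \<open>\<theta>\<close>, and the old left point; \<open>s\<close> is its value from the variance
    relation.\<close>
  define \<theta> where "\<theta> = 1 - \<alpha> * (1 - w) / ((1 - \<alpha>) * w)"
  define a where "a = (1 - w) * D"
  define d where "d = \<alpha> * a / (1 - \<alpha>)"
  define s where "s = sqrt (\<theta> * r\<^sup>2 + (1 - \<theta>) * q\<^sup>2 - \<theta> * (1 - \<theta>) * (w * D)\<^sup>2)"
  have w0: "0 < w" using w \<alpha> by simp
  have "\<alpha> * (1 - w) \<le> (1 - \<alpha>) * w" using w by (simp add: algebra_simps)
  then have \<theta>: "0 \<le> \<theta>" "\<theta> \<le> 1" using w w0 \<alpha> by (simp_all add: \<theta>_def)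
  have \<theta>w: "(1 - \<theta>) * ((1 - \<alpha>) * w) = \<alpha> * (1 - w)" using w0 \<alpha> by (simp add: \<theta>_def)
  have "(1 - \<alpha>) * ((1 - \<theta>) * (w * D)) = (1 - \<theta>) * ((1 - \<alpha>) * w) * D" by simp
  also have "\<dots> = (1 - \<alpha>) * d" unfolding \<theta>w using \<alpha> by (simp add: d_def a_def)
  finally have d: "(1 - \<theta>) * (w * D) = d" using \<alpha> by simp
  have pr: "\<rho>\<^sup>2 \<le> p\<^sup>2" "\<rho>\<^sup>2 \<le> r\<^sup>2" "p\<^sup>2 \<le> \<delta>\<^sup>2" "q\<^sup>2 \<le> \<delta>\<^sup>2" using assms(2-6) \<rho> by (auto intro!: power_mono)
  have "0 \<le> a" using assms by (simp add: a_def)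
  have "p \<le> a" using False assms \<rho> by (simp add: a_def)
  then have pa: "p\<^sup>2 \<le> a\<^sup>2" using assms \<rho> by (intro power_mono) auto
  have \<theta>w': "\<theta> * ((1 - \<alpha>) * w) = w - \<alpha>" "(1 - \<theta>) * w = \<alpha> * (1 - w) / (1 - \<alpha>)"
    using \<theta>w \<alpha> by (simp_all add: field_simps)
  \<comment> \<open>Eliminating \<open>q\<close> yields the variance relation for the splitting into
    \<open>p\<close> and \<open>s\<close> with weights \<open>\<alpha>\<close> and
    \<open>1 - \<alpha>\<close>.\<close>
  have "(1 - \<alpha>) * w * (\<theta> * r\<^sup>2 + (1 - \<theta>) * q\<^sup>2 - \<theta> * (1 - \<theta>) * (w * D)\<^sup>2) =
      \<theta> * ((1 - \<alpha>) * w) * r\<^sup>2 + (1 - \<theta>) * ((1 - \<alpha>) * w) * q\<^sup>2 -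
      \<theta> * ((1 - \<alpha>) * w) * ((1 - \<theta>) * w) * (w * D\<^sup>2)"
    by (simp add: power2_eq_square algebra_simps)
  also have "\<dots> = (w - \<alpha>) * r\<^sup>2 + \<alpha> * (1 - w) * q\<^sup>2 - (w - \<alpha>) * (\<alpha> * (1 - w) / (1 - \<alpha>)) * (w * D\<^sup>2)"
    unfolding \<theta>w \<theta>w' ..
  also have "(1 - w) * q\<^sup>2 = r\<^sup>2 - w * p\<^sup>2 + w * (1 - w) * D\<^sup>2"
    using eq by simp
  then have "\<alpha> * (1 - w) * q\<^sup>2 = \<alpha> * (r\<^sup>2 - w * p\<^sup>2 + w * (1 - w) * D\<^sup>2)"
    by (simp only: mult.assoc[of \<alpha> "1 - w"])
  also have "(w - \<alpha>) * r\<^sup>2 + \<alpha> * (r\<^sup>2 - w * p\<^sup>2 + w * (1 - w) * D\<^sup>2) -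
      (w - \<alpha>) * (\<alpha> * (1 - w) / (1 - \<alpha>)) * (w * D\<^sup>2) =
      w * (r\<^sup>2 - \<alpha> * p\<^sup>2 + \<alpha> * a\<^sup>2 / (1 - \<alpha>))"
    unfolding a_def using \<alpha> by (simp add: divide_simps power2_eq_square) (simp add: algebra_simps)
  finally have "(1 - \<alpha>) * w * (\<theta> * r\<^sup>2 + (1 - \<theta>) * q\<^sup>2 - \<theta> * (1 - \<theta>) * (w * D)\<^sup>2)
     = w * (r\<^sup>2 - \<alpha> * p\<^sup>2 + \<alpha> * a\<^sup>2 / (1 - \<alpha>))" .
  then have s2': "(1 - \<alpha>) * (\<theta> * r\<^sup>2 + (1 - \<theta>) * q\<^sup>2 - \<theta> * (1 - \<theta>) * (w * D)\<^sup>2)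
     = r\<^sup>2 - \<alpha> * p\<^sup>2 + \<alpha> * a\<^sup>2 / (1 - \<alpha>)"
    using w0 by simp
  \<comment> \<open>Since \<open>p \<le> a\<close>, this leads to
    \<open>r\<^sup>2 + d\<^sup>2 \<le> s\<^sup>2\<close>. Hence \<open>r \<le> s\<close>, as
    \<open>gap_min_weight\<close> needs, and \<open>d \<le> s\<close>, which brings the other
    splitting under \<open>gap_nonneg_near\<close>.\<close>
  have "\<alpha> * (r\<^sup>2 - p\<^sup>2 + a\<^sup>2) \<ge> 0"
    using pa \<alpha> zero_le_power2[of r] by (intro mult_nonneg_nonneg) linarith+
  moreover have "(1 - \<alpha>) * (r\<^sup>2 + d\<^sup>2) = (r\<^sup>2 - \<alpha> * p\<^sup>2 + \<alpha> * a\<^sup>2 / (1 - \<alpha>)) - \<alpha> * (r\<^sup>2 - p\<^sup>2 + a\<^sup>2)"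
    unfolding d_def power_divide using \<alpha> by (simp add: divide_simps power2_eq_square) (simp add: algebra_simps)
  ultimately have "(1 - \<alpha>) * (r\<^sup>2 + d\<^sup>2) \<le> (1 - \<alpha>) * (\<theta> * r\<^sup>2 + (1 - \<theta>) * q\<^sup>2 - \<theta> * (1 - \<theta>) * (w * D)\<^sup>2)"
    unfolding s2' by linarith
  then have le: "r\<^sup>2 + d\<^sup>2 \<le> \<theta> * r\<^sup>2 + (1 - \<theta>) * q\<^sup>2 - \<theta> * (1 - \<theta>) * (w * D)\<^sup>2"
    using \<alpha> by simp
  then have s2: "s\<^sup>2 = \<theta> * r\<^sup>2 + (1 - \<theta>) * q\<^sup>2 - \<theta> * (1 - \<theta>) * (w * D)\<^sup>2"
    unfolding s_def by (intro real_sqrt_pow2) (smt (verit) zero_le_power2)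
  have s0: "0 \<le> s" using le by (simp add: s_def) (smt (verit) zero_le_power2)
  have rs: "r \<le> s" using le unfolding s_def by (intro real_le_rsqrt) (smt (verit) zero_le_power2)
  have ds: "d \<le> s" using le unfolding s_def by (intro real_le_rsqrt) (smt (verit) zero_le_power2)
  have "r\<^sup>2 \<le> w * p\<^sup>2 + (1 - w) * q\<^sup>2" using eq w w0 by simp
  also have "\<dots> \<le> \<delta>\<^sup>2" using pr w w0 by (intro convex_bound_le) auto
  finally have "r\<^sup>2 \<le> \<delta>\<^sup>2" .
  have "s\<^sup>2 \<le> \<theta> * r\<^sup>2 + (1 - \<theta>) * q\<^sup>2" using s2 \<theta> by simp
  also have "\<dots> \<le> \<delta>\<^sup>2" using pr \<open>r\<^sup>2 \<le> \<delta>\<^sup>2\<close> \<theta> by (intro convex_bound_le) auto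
  finally have "s\<^sup>2 \<le> \<delta>\<^sup>2" .
  then have s\<delta>: "s \<le> \<delta>" by (rule power2_le_imp_le) (use \<delta> in simp)
  have near: "0 \<le> gap \<theta> (w * D) s r q"
    using assms \<rho> \<theta> w0 s0 ds d by (intro gap_nonneg_near[OF s2]) auto
  have far: "0 \<le> gap \<alpha> (a / (1 - \<alpha>)) r p s"
  proof (rule gap_min_weight)
    have "r\<^sup>2 = \<alpha> * p\<^sup>2 + (1 - \<alpha>) * s\<^sup>2 - \<alpha> * a\<^sup>2 / (1 - \<alpha>)" using s2 s2' by simp
    also have "\<alpha> * a\<^sup>2 / (1 - \<alpha>) = \<alpha> * (1 - \<alpha>) * (a / (1 - \<alpha>))\<^sup>2"
      using \<alpha> by (simp add: power2_eq_square)
    finally show "r\<^sup>2 = \<alpha> * p\<^sup>2 + (1 - \<alpha>) * s\<^sup>2 - \<alpha> * (1 - \<alpha>) * (a / (1 - \<alpha>))\<^sup>2" .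
  qed (use assms \<open>0 \<le> a\<close> \<alpha> rs s\<delta> in auto)
  have "(1 - \<alpha>) * (a / (1 - \<alpha>)) = a" "\<alpha> * (a / (1 - \<alpha>)) = d" using \<alpha> by (simp_all add: d_def)
  then have 1: "\<alpha> * exp a * xe p + (1 - \<alpha>) * (exp (- d) * xe s) \<le> xe r"
    using far by (simp add: gap_def)
  have "exp (- d) * gap \<theta> (w * D) s r q \<ge> 0" using near by simp
  moreover have "exp (- d) * gap \<theta> (w * D) s r q = exp (- d) * xe s -
      \<theta> * (exp (- d) * exp ((1 - \<theta>) * (w * D))) * xe r -
      (1 - \<theta>) * (exp (- d) * exp (- \<theta> * (w * D))) * xe q"
    unfolding gap_def by (simp add: algebra_simps)
  moreover have "exp (- d) * exp ((1 - \<theta>) * (w * D)) = 1"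
    unfolding d by (simp flip: exp_add)
  moreover have \<theta>d: "- \<theta> * (w * D) = d - w * D" using d unfolding left_diff_distrib by linarith
  have "exp (- d) * exp (- \<theta> * (w * D)) = exp (- w * D)"
    unfolding \<theta>d by (simp flip: exp_add)
  ultimately have "\<theta> * xe r + (1 - \<theta>) * exp (- w * D) * xe q \<le> exp (- d) * xe s" by simp
  then have "(1 - \<alpha>) * (\<theta> * xe r + (1 - \<theta>) * exp (- w * D) * xe q) \<le> (1 - \<alpha>) * (exp (- d) * xe s)"
    using \<alpha> by (intro mult_left_mono) auto
  \<comment> \<open>The midpoint is itself a component of the moved point, so \<open>xe r\<close>
    occurs on both sides; collecting it leaves \<open>\<alpha>\<close> times the gap.\<close>
  with 1 have "0 \<le> xe r - \<alpha> * exp a * xe p - (1 - \<alpha>) * (\<theta> * xe r + (1 - \<theta>) * exp (- w * D) * xe q)"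
    by simp
  then have "0 \<le> w * (xe r - \<alpha> * exp a * xe p - (1 - \<alpha>) * (\<theta> * xe r + (1 - \<theta>) * exp (- w * D) * xe q))"
    using w0 by simp
  also have "\<dots> = \<alpha> * gap w D r p q + ((1 - \<theta>) * ((1 - \<alpha>) * w) - \<alpha> * (1 - w)) * (xe r - exp (- w * D) * xe q)"
    unfolding gap_def a_def by (simp add: algebra_simps)
  finally have "0 \<le> \<alpha> * gap w D r p q" using \<theta>w by simp
  then show ?thesis using \<alpha> by (simp add: zero_le_mult_iff)
qed

text \<open>Exchanging the points turns \<open>(w, D)\<close> into \<open>(1 - w, - D)\<close>, so
  with both weights at least \<open>\<alpha>\<close> the sign of \<open>D\<close> is free.\<close>

lemma two_point:
  assumes "\<rho> \<le> p" "p \<le> \<delta>" "\<rho> \<le> q" "q \<le> \<delta>" "\<rho> \<le> r"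
    and w: "\<alpha> \<le> w" "w \<le> 1 - \<alpha>"
    and eq: "r\<^sup>2 = w * p\<^sup>2 + (1 - w) * q\<^sup>2 - w * (1 - w) * D\<^sup>2"
  shows "0 \<le> gap w D r p q"
proof (cases "0 \<le> D")
  case True
  show ?thesis using True assms \<alpha> by (intro gap_nonneg_right) auto
next
  case False
  have "0 \<le> gap (1 - w) (- D) r q p"
    using False assms \<alpha> by (intro gap_nonneg_right) (auto simp: algebra_simps)
  also have "gap (1 - w) (- D) r q p = gap w D r p q"
    by (simp add: gap_def algebra_simps)
  finally show ?thesis .
qed

end

section \<open>Existence of the parameters\<close>

text \<open>With \<open>\<rho> = sqrt (\<delta>\<^sup>2 - \<epsilon>\<^sup>2)\<close>,
  \<open>jump\<close> is solved for \<open>\<delta>\<close> between \<open>\<epsilon>\<close> and 1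
  by the intermediate value theorem. The bound \<open>eps0\<close> gives \<open>den > 0\<close>,
  hence the sign at 1.\<close>

lemma bellman_exists:
  assumes \<alpha>: "0 < \<alpha>" "\<alpha> < 1" and \<epsilon>: "0 < \<epsilon>" "\<epsilon> < eps0 \<alpha>"
  obtains \<delta> \<rho> where "bellman \<alpha> \<epsilon> \<delta> \<rho>"
proof -
  define den where "den = exp (sqrt \<alpha> * \<epsilon>) - \<alpha> * exp (\<epsilon> / sqrt \<alpha>)"
  define c where "c = sqrt \<alpha>"
  have c: "0 < c" "c < 1" "\<alpha> = c\<^sup>2" using \<alpha> by (simp_all add: c_def)
  have "\<epsilon> < c / (1 - \<alpha>) * - ln \<alpha>" using \<epsilon> \<alpha> by (simp add: eps0_def c_def ln_div)
  then have "\<epsilon> * (1 - \<alpha>) < c * - ln \<alpha>" using \<alpha> by (simp add: field_simps)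
  then have "\<epsilon> * (1 - \<alpha>) / c < - ln \<alpha>" using c by (simp add: divide_less_eq mult.commute)
  moreover have "\<epsilon> * (1 - \<alpha>) / c = \<epsilon> / c - c * \<epsilon>" using c by (simp add: field_simps power2_eq_square)
  ultimately have "exp (ln \<alpha> + \<epsilon> / c) < exp (c * \<epsilon>)" by simp
  then have den: "0 < den" using \<alpha> by (simp add: den_def c_def exp_add)
  \<comment> \<open>Up to the factor \<open>exp (- \<alpha> * x1)\<close>, \<open>h x1\<close> is
    \<open>den - (1 - \<alpha>) * xe \<epsilon>\<close>, which decides the sign at
    \<open>\<epsilon>\<close>. It is negative because \<open>h 0 = 0\<close> and \<open>h\<close>
    decreases on the positive axis.\<close>
  define h where "h = (\<lambda>x. 1 - \<alpha> * exp ((1 - \<alpha>) * x) - (1 - \<alpha>) * exp (- \<alpha> * x) * xe (c * x))"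
  have dh: "(h has_real_derivative \<alpha> * (1 - \<alpha>) * exp ((c - \<alpha>) * x) * (1 + (1 - c) * x - exp ((1 - c) * x))) (at x)" for x
  proof -
    have e: "exp (- \<alpha> * x) * exp (c * x) = exp ((c - \<alpha>) * x)"
      "exp ((1 - \<alpha>) * x) = exp ((c - \<alpha>) * x) * exp ((1 - c) * x)"
      by (simp_all flip: exp_add add: algebra_simps)
    have "(h has_real_derivative 0 - \<alpha> * (exp ((1 - \<alpha>) * x) * (1 - \<alpha>)) -
       ((1 - \<alpha>) * (exp (- \<alpha> * x) * - \<alpha>) * xe (c * x) +
        (1 - \<alpha>) * exp (- \<alpha> * x) * ((- (c * x) * exp (c * x)) * c))) (at x)"
      unfolding h_def by (auto intro!: derivative_eq_intros simp: algebra_simps)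
    moreover have "0 - \<alpha> * (exp ((1 - \<alpha>) * x) * (1 - \<alpha>)) -
       ((1 - \<alpha>) * (exp (- \<alpha> * x) * - \<alpha>) * xe (c * x) +
        (1 - \<alpha>) * exp (- \<alpha> * x) * ((- (c * x) * exp (c * x)) * c)) =
       (1 - \<alpha>) * (\<alpha> * (1 - c * x) * (exp (- \<alpha> * x) * exp (c * x)) + c\<^sup>2 * x * (exp (- \<alpha> * x) * exp (c * x))
         - \<alpha> * exp ((1 - \<alpha>) * x))"
      by (simp add: xe_def power2_eq_square algebra_simps)
    moreover have "\<dots> = \<alpha> * (1 - \<alpha>) * exp ((c - \<alpha>) * x) * (1 + (1 - c) * x - exp ((1 - c) * x))"
      unfolding e c(3)[symmetric] by (simp add: algebra_simps)
    ultimately show ?thesis by (simp only:)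
  qed
  define x1 where "x1 = \<epsilon> / c"
  have x1: "0 < x1" "c * x1 = \<epsilon>" using \<epsilon> c by (simp_all add: x1_def)
  obtain z where z: "0 < z" "h x1 - h 0 = (x1 - 0) * (\<alpha> * (1 - \<alpha>) * exp ((c - \<alpha>) * z) * (1 + (1 - c) * z - exp ((1 - c) * z)))"
    using MVT2[OF x1(1), of h "\<lambda>x. \<alpha> * (1 - \<alpha>) * exp ((c - \<alpha>) * x) * (1 + (1 - c) * x - exp ((1 - c) * x))"] dh by blast
  have "1 + (1 - c) * z + ((1 - c) * z)\<^sup>2 / 2 \<le> exp ((1 - c) * z)"
    using z c by (intro exp_lower_Taylor_quadratic) auto
  moreover have "((1 - c) * z)\<^sup>2 > 0" using z c by simp
  ultimately have "1 + (1 - c) * z - exp ((1 - c) * z) < 0" by linarith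
  then have "h x1 - h 0 < 0" unfolding z(2) using x1 \<alpha> by (simp add: mult_pos_neg)
  then have "h x1 * exp (\<alpha> * x1) < 0" by (simp add: h_def xe_def mult_less_0_iff)
  moreover have "h x1 * exp (\<alpha> * x1) = exp (\<alpha> * x1) - \<alpha> * (exp ((1 - \<alpha>) * x1) * exp (\<alpha> * x1)) -
      (1 - \<alpha>) * (exp (- \<alpha> * x1) * exp (\<alpha> * x1)) * xe \<epsilon>"
    unfolding h_def x1(2) by (simp add: algebra_simps)
  moreover have "exp ((1 - \<alpha>) * x1) * exp (\<alpha> * x1) = exp x1" "exp (- \<alpha> * x1) * exp (\<alpha> * x1) = 1"
    by (simp_all flip: exp_add add: algebra_simps)
  moreover have "\<alpha> * x1 = c * \<epsilon>" using c by (simp add: x1_def power2_eq_square)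
  ultimately have den_less: "den < (1 - \<alpha>) * xe \<epsilon>" by (simp add: den_def x1_def c_def)
  then have "0 < (1 - \<alpha>) * xe \<epsilon>" using den by simp
  then have "\<epsilon> < 1" using \<alpha> by (simp add: xe_def zero_less_mult_iff)
  define f where "f = (\<lambda>d. (1 - \<alpha>) * xe d - xe (sqrt (d\<^sup>2 - \<epsilon>\<^sup>2)) * den)"
  have f\<epsilon>: "0 < f \<epsilon>" using den_less by (simp add: f_def xe_def)
  have "sqrt (1 - \<epsilon>\<^sup>2) < 1" using \<epsilon> by simp
  then have f1: "f 1 < 0" using den xe_pos[of "sqrt (1 - \<epsilon>\<^sup>2)"] by (simp add: f_def xe_def[of 1])
  have "continuous_on {\<epsilon>..1} f" unfolding f_def by (intro continuous_intros)
  then obtain d where d: "\<epsilon> \<le> d" "d \<le> 1" "f d = 0"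
    using IVT2'[of f 1 0 \<epsilon>] f\<epsilon> f1 \<open>\<epsilon> < 1\<close> by auto
  then have d': "\<epsilon> < d" "d < 1" using f\<epsilon> f1 by (auto simp: order_less_le)
  then have "\<epsilon>\<^sup>2 < d\<^sup>2" using \<epsilon> by (intro power_strict_mono) auto
  then have "bellman \<alpha> \<epsilon> d (sqrt (d\<^sup>2 - \<epsilon>\<^sup>2))"
    using \<alpha> \<epsilon> d' d(3) by unfold_locales (auto simp: f_def den_def algebra_simps)
  then show ?thesis by (rule that)
qed

section \<open>Means and variances of finite mixtures\<close>

definition wmean :: "'i set \<Rightarrow> ('i \<Rightarrow> real) \<Rightarrow> ('i \<Rightarrow> real) \<Rightarrow> real" where
  "wmean S p x = (\<Sum>i\<in>S. p i * x i) / sum p S"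

text \<open>The variance of a mixture whose components have means \<open>x i\<close> and variances \<open>t i\<close>.\<close>

definition wvar :: "'i set \<Rightarrow> ('i \<Rightarrow> real) \<Rightarrow> ('i \<Rightarrow> real) \<Rightarrow> ('i \<Rightarrow> real) \<Rightarrow> real" where
  "wvar S p x t = wmean S p (\<lambda>i. t i + (x i)\<^sup>2) - (wmean S p x)\<^sup>2"

text \<open>Law of total variance in centred form; the squares are expanded about the common
  mean.\<close>

lemma wvar_eq:
  assumes "sum p S \<noteq> 0"
  shows "sum p S * wvar S p x t = (\<Sum>i\<in>S. p i * (t i + (x i - wmean S p x)\<^sup>2))"
proof -
  define X where "X = wmean S p x"
  have X: "(\<Sum>i\<in>S. p i * x i) = sum p S * X" using assms by (simp add: X_def wmean_def)
  have "(\<Sum>i\<in>S. p i * (t i + (x i - X)\<^sup>2)) =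
      (\<Sum>i\<in>S. p i * (t i + (x i)\<^sup>2) - 2 * X * (p i * x i) + X\<^sup>2 * p i)"
    by (intro sum.cong) (auto simp: power2_eq_square algebra_simps)
  also have "\<dots> = (\<Sum>i\<in>S. p i * (t i + (x i)\<^sup>2)) - 2 * X * (\<Sum>i\<in>S. p i * x i) + X\<^sup>2 * sum p S"
    by (simp only: sum.distrib sum_subtractf sum_distrib_left)
  also have "\<dots> = sum p S * wvar S p x t"
    unfolding X using assms by (simp add: wvar_def wmean_def X_def[symmetric] field_simps power2_eq_square)
      (simp add: X_def wmean_def)
  finally show ?thesis by (simp add: X_def)
qed

lemma wvar_nonneg:
  assumes "0 < sum p S" "\<And>i. i \<in> S \<Longrightarrow> 0 \<le> p i" "\<And>i. i \<in> S \<Longrightarrow> 0 \<le> t i"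
  shows "0 \<le> wvar S p x t"
proof -
  have "0 \<le> sum p S * wvar S p x t"
    using assms wvar_eq[of p S x t] by (auto intro!: sum_nonneg)
  then show ?thesis using assms by (simp add: zero_le_mult_iff)
qed

lemma wmean_remove:
  assumes "finite S" "i \<in> S" "sum p S \<noteq> 0" "sum p (S - {i}) \<noteq> 0"
  shows "wmean S p x = p i / sum p S * x i + (1 - p i / sum p S) * wmean (S - {i}) p x"
proof -
  have "sum p S = p i + sum p (S - {i})" using assms by (simp add: sum.remove)
  moreover have "(\<Sum>i\<in>S. p i * x i) = p i * x i + (\<Sum>i\<in>S - {i}. p i * x i)"
    using assms by (simp add: sum.remove)
  ultimately show ?thesis using assms(3,4) by (simp add: wmean_def divide_simps)
qed

text \<open>Law of total variance for two components, \<open>i\<close> and the rest; it drives the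
  induction over components.\<close>

lemma wvar_remove:
  assumes "finite S" "i \<in> S" "sum p S \<noteq> 0" "sum p (S - {i}) \<noteq> 0"
  defines "w \<equiv> p i / sum p S"
  shows "wvar S p x t = w * t i + (1 - w) * wvar (S - {i}) p x t +
    w * (1 - w) * (x i - wmean (S - {i}) p x)\<^sup>2"
  unfolding wvar_def wmean_remove[OF assms(1-4)] w_def[symmetric]
  by (simp add: power2_eq_square algebra_simps)

text \<open>If removing any single component raised the variance above \<open>e\<close>, averaging would
  contradict the law of total variance.\<close>

lemma exists_remove_wvar_le:
  assumes "finite S" "S \<noteq> {}" "\<And>i. i \<in> S \<Longrightarrow> 0 < p i" "\<And>i. i \<in> S \<Longrightarrow> sum p (S - {i}) > 0"
    and "wvar S p x t \<le> e"
  shows "\<exists>i\<in>S. wvar (S - {i}) p x t \<le> e"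
proof (rule ccontr)
  assume "\<not> ?thesis"
  then have gt: "wvar S p x t < wvar (S - {i}) p x t" if "i \<in> S" for i
    using assms(5) that by force
  have P: "0 < sum p S" using assms by (intro sum_pos) auto
  \<comment> \<open>If removing \<open>i\<close> raises the variance, then \<open>i\<close>
    contributes less than the average to it; summed over all \<open>i\<close> this contradicts
    \<open>wvar_eq\<close>.\<close>
  have "p i * (t i + (x i - wmean S p x)\<^sup>2) < p i * wvar S p x t" if i: "i \<in> S" for i
  proof -
    define w where "w = p i / sum p S"
    define d where "d = x i - wmean (S - {i}) p x"
    have "sum p S = p i + sum p (S - {i})" using assms i by (simp add: sum.remove)
    then have w: "0 < w" "w < 1" using assms i P by (auto simp: w_def)
    have S: "sum p S \<noteq> 0" "sum p (S - {i}) \<noteq> 0" using P assms(4)[OF i] by auto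
    have "wvar S p x t = w * t i + (1 - w) * wvar (S - {i}) p x t + w * (1 - w) * d\<^sup>2"
      using wvar_remove[of S i p x t] assms i S by (simp add: w_def d_def)
    moreover have "(1 - w) * wvar S p x t < (1 - w) * wvar (S - {i}) p x t"
      using gt[OF i] w by simp
    ultimately have "w * (t i + (1 - w) * d\<^sup>2) < w * wvar S p x t" by (simp add: algebra_simps)
    then have "t i + (1 - w) * d\<^sup>2 < wvar S p x t" using w by simp
    moreover have "x i - wmean S p x = (1 - w) * d"
      using wmean_remove[of S i p x] assms i S by (simp add: w_def d_def algebra_simps)
    then have "(x i - wmean S p x)\<^sup>2 = (1 - w) * ((1 - w) * d\<^sup>2)" by (simp add: power2_eq_square)
    then have "(x i - wmean S p x)\<^sup>2 \<le> (1 - w) * d\<^sup>2"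
      using w by (simp add: mult_left_le_one_le)
    ultimately have "t i + (x i - wmean S p x)\<^sup>2 < wvar S p x t" by linarith
    then show ?thesis using assms(3)[OF i] by simp
  qed
  then have "(\<Sum>i\<in>S. p i * (t i + (x i - wmean S p x)\<^sup>2)) < (\<Sum>i\<in>S. p i * wvar S p x t)"
    using assms by (intro sum_strict_mono) auto
  then show False using wvar_eq[of p S x t] P by (simp add: sum_distrib_right)
qed

section \<open>The Bellman function on finite mixtures\<close>

context bellman begin

definition bell :: "real \<Rightarrow> real \<Rightarrow> real" where
  "bell x t = exp x * xe (sqrt (\<delta>\<^sup>2 - t)) / xe \<delta>"

lemma bell_ge:
  assumes "0 \<le> t" "t \<le> \<epsilon>\<^sup>2"
  shows "exp x \<le> bell x t"
proof -
  have "t \<le> \<delta>\<^sup>2" using assms \<delta>(3) zero_le_power2[of \<rho>] by linarith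
  then have "sqrt (\<delta>\<^sup>2 - t) \<le> \<delta>" "0 \<le> sqrt (\<delta>\<^sup>2 - t)"
    using assms(1) \<delta>(1) by (auto intro: real_le_lsqrt)
  then have "xe \<delta> \<le> xe (sqrt (\<delta>\<^sup>2 - t))" by (intro xe_antimono)
  then show ?thesis using xe_pos[of \<delta>] \<delta> by (simp add: bell_def field_simps)
qed

lemma bell_le:
  assumes "t \<le> \<epsilon>\<^sup>2"
  shows "bell x t \<le> K_const \<alpha> \<epsilon> * exp x"
proof -
  have "\<rho> \<le> sqrt (\<delta>\<^sup>2 - t)" using assms \<delta> \<rho> by (intro real_le_rsqrt) auto
  then have "xe (sqrt (\<delta>\<^sup>2 - t)) \<le> xe \<rho>" using \<rho> by (intro xe_antimono) auto
  then have "exp x * xe (sqrt (\<delta>\<^sup>2 - t)) / xe \<delta> \<le> exp x * xe \<rho> / xe \<delta>"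
    using xe_pos[of \<delta>] \<delta> by (intro divide_right_mono mult_left_mono) auto
  also have "xe \<rho> / xe \<delta> = K_const \<alpha> \<epsilon>"
  proof -
    have "xe \<delta> \<noteq> 0" using xe_pos[of \<delta>] \<delta> by auto
    moreover from this have "exp (sqrt \<alpha> * \<epsilon>) - \<alpha> * exp (\<epsilon> / sqrt \<alpha>) \<noteq> 0" using jump \<alpha> by auto
    ultimately show ?thesis unfolding K_const_def using jump by (subst frac_eq_eq) auto
  qed
  then have "exp x * xe \<rho> / xe \<delta> = K_const \<alpha> \<epsilon> * exp x" by (simp flip: times_divide_eq_right)
  finally show ?thesis by (simp add: bell_def)
qed

text \<open>\<open>G\<close> turns the three variances into the arguments \<open>p\<close>,
  \<open>q\<close>, \<open>r\<close> of \<open>two_point\<close>, whose inequality is then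
  multiplied by the exponential of the mean.\<close>

lemma bell_two_point:
  assumes "0 \<le> s" "s \<le> \<epsilon>\<^sup>2" "0 \<le> t" "t \<le> \<epsilon>\<^sup>2" "\<alpha> \<le> w" "w \<le> 1 - \<alpha>"
    and le: "w * s + (1 - w) * t + w * (1 - w) * (x - y)\<^sup>2 \<le> \<epsilon>\<^sup>2"
  shows "w * bell x s + (1 - w) * bell y t \<le>
    bell (w * x + (1 - w) * y) (w * s + (1 - w) * t + w * (1 - w) * (x - y)\<^sup>2)"
proof -
  define X where "X = w * x + (1 - w) * y"
  define T where "T = w * s + (1 - w) * t + w * (1 - w) * (x - y)\<^sup>2"
  define G where "G = (\<lambda>t. sqrt (\<delta>\<^sup>2 - t))"
  have G: "\<rho> \<le> G t" "(G t)\<^sup>2 = \<delta>\<^sup>2 - t" if "t \<le> \<epsilon>\<^sup>2" for t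
  proof -
    have "\<rho>\<^sup>2 \<le> \<delta>\<^sup>2 - t" using that \<delta>(3) by linarith
    then show "\<rho> \<le> G t" unfolding G_def by (rule real_le_rsqrt)
    show "(G t)\<^sup>2 = \<delta>\<^sup>2 - t"
      using that \<delta>(3) zero_le_power2[of \<rho>] unfolding G_def by (intro real_sqrt_pow2) linarith
  qed
  have G': "G t \<le> \<delta>" if "0 \<le> t" "t \<le> \<epsilon>\<^sup>2" for t
    by (rule power2_le_imp_le) (use that G(2)[of t] \<delta>(1) in auto)
  have T: "0 \<le> T" "T \<le> \<epsilon>\<^sup>2" using assms \<alpha> by (simp_all add: T_def)
  have "(G T)\<^sup>2 = w * (G s)\<^sup>2 + (1 - w) * (G t)\<^sup>2 - w * (1 - w) * (x - y)\<^sup>2"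
    unfolding G(2)[OF T(2)] G(2)[OF assms(2)] G(2)[OF assms(4)] unfolding T_def by (simp add: algebra_simps)
  then have "0 \<le> gap w (x - y) (G T) (G s) (G t)"
    using assms(1-6) T G(1) G' by (intro two_point)
  then have "0 \<le> exp X * gap w (x - y) (G T) (G s) (G t)" by simp
  also have "\<dots> = exp X * xe (G T) - w * (exp X * exp ((1 - w) * (x - y)) * xe (G s)) -
      (1 - w) * (exp X * exp (- w * (x - y)) * xe (G t))"
    unfolding gap_def by (simp add: algebra_simps)
  also have "exp X * exp ((1 - w) * (x - y)) = exp x"
    unfolding X_def by (simp flip: exp_add add: algebra_simps)
  also have "exp X * exp (- w * (x - y)) = exp y"
    unfolding X_def by (simp flip: exp_add add: algebra_simps)
  finally have "w * (exp x * xe (G s)) + (1 - w) * (exp y * xe (G t)) \<le> exp X * xe (G T)" by simp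
  then have "(w * (exp x * xe (G s)) + (1 - w) * (exp y * xe (G t))) / xe \<delta> \<le> exp X * xe (G T) / xe \<delta>"
    using xe_pos[of \<delta>] \<delta> by (intro divide_right_mono) auto
  then show ?thesis by (simp add: bell_def G_def X_def T_def add_divide_distrib)
qed

text \<open>Induction over components: one is split off so that the rest keeps variance at most
  \<open>\<epsilon>\<^sup>2\<close>, and \<open>bell_two_point\<close> joins it to the rest. The
  rest has weight at least \<open>\<alpha>\<close> because it contains another component.\<close>

lemma bell_finite_mixture:
  assumes "finite S" "S \<noteq> {}"
    and "\<And>i. i \<in> S \<Longrightarrow> 0 < p i" "\<And>i. i \<in> S \<Longrightarrow> \<alpha> * sum p S \<le> p i"
    and t: "\<And>i. i \<in> S \<Longrightarrow> 0 \<le> t i" "\<And>i. i \<in> S \<Longrightarrow> t i \<le> \<epsilon>\<^sup>2"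
    and "wvar S p x t \<le> \<epsilon>\<^sup>2"
  shows "(\<Sum>i\<in>S. p i * bell (x i) (t i)) \<le> sum p S * bell (wmean S p x) (wvar S p x t)"
  using assms(1-4,7) t
proof (induction S rule: finite_psubset_induct)
  case (psubset S)
  have P: "0 < sum p S" using psubset by (intro sum_pos) auto
  show ?case
  proof (cases "\<exists>i. S = {i}")
    case True
    then obtain i where "S = {i}" by blast
    then show ?thesis using psubset.prems(2)[of i] by (simp add: wvar_def wmean_def)
  next
    case False
    have ne: "S - {i} \<noteq> {}" if "i \<in> S" for i using False that by blast
    have Q: "0 < sum p (S - {i})" if "i \<in> S" for i
      using psubset ne[OF that] by (intro sum_pos) auto
    obtain i where i: "i \<in> S" "wvar (S - {i}) p x t \<le> \<epsilon>\<^sup>2"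
      using exists_remove_wvar_le[of S p x t "\<epsilon>\<^sup>2"] psubset Q by auto
    define w where "w = p i / sum p S"
    define U where "U = S - {i}"
    have sum_split: "sum p S = p i + sum p U" using psubset i by (simp add: U_def sum.remove)
    obtain j where j: "j \<in> U" using ne[OF i(1)] by (auto simp: U_def)
    have "\<alpha> * sum p S \<le> p j" using psubset j by (auto simp: U_def)
    also have "p j \<le> sum p U" using psubset j by (intro member_le_sum) (auto simp: U_def less_imp_le)
    finally have "\<alpha> \<le> sum p U / sum p S" using P by (simp add: le_divide_eq)
    also have "sum p U / sum p S = 1 - w" using sum_split P by (simp add: w_def field_simps)
    finally have w: "\<alpha> \<le> w" "w \<le> 1 - \<alpha>" using psubset.prems(3)[OF i(1)] P by (auto simp: w_def le_divide_eq)
    have S: "sum p S \<noteq> 0" "sum p (S - {i}) \<noteq> 0" using P Q[OF i(1)] by auto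
    have U0: "0 \<le> wvar U p x t"
      using psubset.prems Q[OF i(1)] by (intro wvar_nonneg) (auto simp: U_def less_imp_le)
    have IH: "(\<Sum>i\<in>U. p i * bell (x i) (t i)) \<le> sum p U * bell (wmean U p x) (wvar U p x t)"
    proof (rule psubset.IH)
      fix k assume k: "k \<in> U"
      have "sum p U \<le> sum p S" using sum_split psubset.prems(2)[OF i(1)] by simp
      then have "\<alpha> * sum p U \<le> \<alpha> * sum p S" using \<alpha> by simp
      also have "\<dots> \<le> p k" using psubset.prems k by (auto simp: U_def)
      finally show "\<alpha> * sum p U \<le> p k" .
    qed (use psubset.prems i ne[OF i(1)] in \<open>auto simp: U_def\<close>)
    note var = wvar_remove[OF psubset.hyps(1) i(1) S, of x t, folded w_def U_def]
    note mean = wmean_remove[OF psubset.hyps(1) i(1) S, of x, folded w_def U_def]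
    have "w * bell (x i) (t i) + (1 - w) * bell (wmean U p x) (wvar U p x t) \<le>
        bell (wmean S p x) (wvar S p x t)"
      unfolding var mean
      by (rule bell_two_point) (use psubset.prems i U0 w in \<open>auto simp: var[symmetric] U_def[symmetric]\<close>)
    then have "sum p S * (w * bell (x i) (t i) + (1 - w) * bell (wmean U p x) (wvar U p x t)) \<le>
        sum p S * bell (wmean S p x) (wvar S p x t)"
      using P by simp
    moreover have "sum p S * w = p i" "sum p S * (1 - w) = sum p U"
      using P sum_split by (simp_all add: w_def right_diff_distrib)
    then have "sum p S * (w * bell (x i) (t i) + (1 - w) * bell (wmean U p x) (wvar U p x t)) =
       p i * bell (x i) (t i) + sum p U * bell (wmean U p x) (wvar U p x t)"
      by (metis (no_types, opaque_lifting) distrib_left mult.assoc)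
    moreover have "(\<Sum>i\<in>S. p i * bell (x i) (t i)) = p i * bell (x i) (t i) + (\<Sum>i\<in>U. p i * bell (x i) (t i))"
      using psubset i by (simp add: U_def sum.remove)
    ultimately show ?thesis using IH by linarith
  qed
qed

end

section \<open>Averages and variances on the tree\<close>

text \<open>The child map \<open>C\<close> is fixed here. The differentiation property is left out
  and enters pointwise, as a hypothesis of \<open>liminf_tree_exp\<close>.\<close>

locale finite_alpha_tree = finite_measure M
  for M :: "'a measure" +
  fixes \<alpha> :: real and T :: "'a set set" and C :: "'a set \<Rightarrow> 'a set set"
  assumes \<alpha>_pos: "0 < \<alpha>"
    and space_pos: "0 < measure M (space M)"
    and tree_sets: "T \<subseteq> sets M"
    and children_sub: "J \<in> T \<Longrightarrow> C J \<subseteq> T"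
    and children_Union: "J \<in> T \<Longrightarrow> J = \<Union> (C J)"
    and children_null: "\<lbrakk>J \<in> T; I \<in> C J; I' \<in> C J; I \<noteq> I'\<rbrakk> \<Longrightarrow> emeasure M (I \<inter> I') = 0"
    and children_ge: "\<lbrakk>J \<in> T; I \<in> C J\<rbrakk> \<Longrightarrow> \<alpha> * measure M J \<le> measure M I"
    and generations: "T = (\<Union>m. generation (space M) C m)"
begin

lemma tree_pos:
  assumes "J \<in> T"
  shows "0 < measure M J"
proof -
  have "\<forall>J\<in>generation (space M) C m. 0 < measure M J" for m
  proof (induction m)
    case (Suc m)
    have "0 < measure M I" if "J \<in> generation (space M) C m" "I \<in> C J" for I J
    proof -
      have "J \<in> T" using that generations by auto
      then have "\<alpha> * measure M J \<le> measure M I" using that children_ge by auto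
      moreover have "0 < \<alpha> * measure M J" using Suc that \<alpha>_pos by simp
      ultimately show ?thesis by linarith
    qed
    then show ?case by auto
  qed (use space_pos in simp)
  then show ?thesis using assms generations by auto
qed

text \<open>Stated for finite subfamilies, since it serves to prove that \<open>C J\<close> is
  finite.\<close>

lemma set_integral_children:
  fixes f :: "'a \<Rightarrow> real"
  assumes "J \<in> T" "F \<subseteq> C J" "finite F" "integrable M f"
  shows "(LINT x:\<Union>F|M. f x) = (\<Sum>I\<in>F. LINT x:I|M. f x)"
proof -
  have F: "F \<subseteq> sets M" using assms children_sub tree_sets by blast
  have "(LINT x:(\<Union>I\<in>F. I)|M. f x) = (\<Sum>I\<in>F. LINT x:I|M. f x)"
  proof (rule set_integral_finite_UN_AE[OF \<open>finite F\<close>])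
    fix I I' assume I: "I \<in> F" "I' \<in> F"
    show "AE x in M. x \<in> I \<and> x \<in> I' \<longrightarrow> I = I'"
    proof (cases "I = I'")
      case False
      then have "emeasure M (I \<inter> I') = 0" using I assms children_null by blast
      then have "I \<inter> I' \<in> null_sets M" using I F by (intro null_setsI) auto
      from AE_not_in[OF this] show ?thesis by eventually_elim auto
    qed simp
  next
    fix I assume "I \<in> F"
    then show "I \<in> sets M" using F by auto
    then show "set_integrable M I f"
      unfolding set_integrable_def using assms(4) by (rule integrable_mult_indicator)
  qed
  then show ?thesis by simp
qed

lemma measure_children:
  assumes "J \<in> T" "F \<subseteq> C J" "finite F"
  shows "measure M (\<Union>F) = (\<Sum>I\<in>F. measure M I)"
proof -
  have "F \<subseteq> sets M" using assms children_sub tree_sets by blast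
  then show ?thesis
    using set_integral_children[OF assms, of "\<lambda>_. 1"] assms(3)
    by (simp add: set_lebesgue_integral_def subset_iff sets.finite_Union)
qed

text \<open>More than \<open>1 / \<alpha>\<close> almost disjoint children would have total measure
  exceeding that of \<open>J\<close>.\<close>

lemma finite_children:
  assumes J: "J \<in> T"
  shows "finite (C J)"
proof (rule ccontr)
  assume "infinite (C J)"
  obtain n :: nat where n: "1 / \<alpha> < real n" using reals_Archimedean2 by blast
  obtain F where F: "F \<subseteq> C J" "finite F" "card F = n"
    using infinite_arbitrarily_large[OF \<open>infinite (C J)\<close>] by blast
  have "real n * (\<alpha> * measure M J) \<le> (\<Sum>I\<in>F. measure M I)"
    using F J children_ge by (subst F(3)[symmetric], intro sum_bounded_below) auto
  also have "\<dots> = measure M (\<Union>F)" using measure_children[OF J F(1,2)] by simp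
  also have "\<dots> \<le> measure M J"
    using F children_Union[OF J] tree_sets J by (intro finite_measure_mono) auto
  finally have "real n * \<alpha> \<le> 1" using tree_pos[OF J] by simp
  then show False using n \<alpha>_pos by (simp add: field_simps)
qed

lemma children_nonempty: "J \<in> T \<Longrightarrow> C J \<noteq> {}"
  using tree_pos[of J] children_Union[of J] by auto

lemma sum_measure_children: "J \<in> T \<Longrightarrow> sum (measure M) (C J) = measure M J"
  using measure_children[of J "C J"] finite_children[of J] children_Union[of J] by simp

lemma avg_children:
  fixes f :: "'a \<Rightarrow> real"
  assumes "J \<in> T" "integrable M f"
  shows "avg M J f = wmean (C J) (measure M) (\<lambda>I. avg M I f)"
proof -
  have "measure M I * avg M I f = (LINT x:I|M. f x)" if "I \<in> C J" for I
    using tree_pos[of I] children_sub[OF assms(1)] that by (auto simp: avg_def)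
  then show ?thesis
    using set_integral_children[OF assms(1) order_refl finite_children assms(2)] assms
      children_Union[OF assms(1)] by (simp add: avg_def wmean_def sum_measure_children)
qed

definition variance_on :: "('a \<Rightarrow> real) \<Rightarrow> 'a set \<Rightarrow> real" where
  "variance_on f J = avg M J (\<lambda>x. (f x)\<^sup>2) - (avg M J f)\<^sup>2"

lemma variance_on_children:
  assumes "J \<in> T" "integrable M f" "integrable M (\<lambda>x. (f x)\<^sup>2)"
  shows "variance_on f J = wvar (C J) (measure M) (\<lambda>I. avg M I f) (variance_on f)"
  unfolding variance_on_def wvar_def using assms by (simp add: avg_children)

lemma variance_on_nonneg:
  assumes J: "J \<in> T" and f: "integrable M f" "integrable M (\<lambda>x. (f x)\<^sup>2)"
  shows "0 \<le> variance_on f J"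
proof -
  define m where "m = avg M J f"
  have JM: "J \<in> sets M" using J tree_sets by auto
  have i: "set_integrable M J f" "set_integrable M J (\<lambda>x. (f x)\<^sup>2)" "set_integrable M J (\<lambda>x. c)" for c :: real
    using f JM unfolding set_integrable_def by (intro integrable_mult_indicator; simp)+
  have "0 \<le> (LINT x:J|M. (f x - m)\<^sup>2)"
    unfolding set_lebesgue_integral_def by (intro integral_nonneg_AE) auto
  also have "\<dots> = (LINT x:J|M. ((f x)\<^sup>2 - (2 * m) * f x) + m\<^sup>2)"
    by (simp add: power2_diff algebra_simps)
  also have "\<dots> = (LINT x:J|M. (f x)\<^sup>2) - 2 * m * (LINT x:J|M. f x) + (LINT x:J|M. m\<^sup>2)"
    using i by (simp add: set_integral_add set_integral_diff)
  also have "(LINT x:J|M. m\<^sup>2) = measure M J * m\<^sup>2"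
    using JM by (simp add: set_lebesgue_integral_def)
  also have "(LINT x:J|M. f x) = measure M J * m" using tree_pos[OF J] by (simp add: m_def avg_def)
  also have "(LINT x:J|M. (f x)\<^sup>2) = measure M J * avg M J (\<lambda>x. (f x)\<^sup>2)"
    using tree_pos[OF J] by (simp add: avg_def)
  finally have "0 \<le> measure M J * variance_on f J"
    by (simp add: variance_on_def m_def power2_eq_square algebra_simps)
  then show ?thesis using tree_pos[OF J] by (simp add: zero_le_mult_iff)
qed

section \<open>Exponentials of averages along the generations\<close>

text \<open>The exponential of the averages of \<open>f\<close> over the descendants of \<open>J\<close> after \<open>n\<close>
  generations, summed where descendants overlap.\<close>

primrec tree_exp :: "('a \<Rightarrow> real) \<Rightarrow> nat \<Rightarrow> 'a set \<Rightarrow> 'a \<Rightarrow> ennreal" where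
  "tree_exp f 0 J x = ennreal (exp (avg M J f)) * indicator J x"
| "tree_exp f (Suc n) J x = (\<Sum>I\<in>C J. tree_exp f n I x)"

lemma tree_exp_measurable: "J \<in> T \<Longrightarrow> tree_exp f n J \<in> borel_measurable M"
proof (induction n arbitrary: J)
  case 0
  then have "J \<in> sets M" using tree_sets by auto
  then show ?case by (simp add: fun_eq_iff cong: measurable_cong) measurable
next
  case (Suc n)
  then have "(\<lambda>x. \<Sum>I\<in>C J. tree_exp f n I x) \<in> borel_measurable M"
    using children_sub by (intro borel_measurable_sum) auto
  then show ?case by simp
qed

text \<open>A single line of descent contributes one of the nonnegative terms of the sum.\<close>

lemma tree_exp_chain:
  assumes "\<And>n. s n \<in> T" "\<And>n. s (Suc n) \<in> C (s n)" "\<And>n. x \<in> s n"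
  shows "ennreal (exp (avg M (s n) f)) \<le> tree_exp f n (s 0) x"
  using assms
proof (induction n arbitrary: s)
  case 0
  then show ?case by simp
next
  case (Suc n)
  have "ennreal (exp (avg M (s (Suc n)) f)) \<le> tree_exp f n (s (Suc 0)) x"
    using Suc.IH[of "\<lambda>n. s (Suc n)"] Suc.prems by simp
  also have "\<dots> \<le> (\<Sum>I\<in>C (s 0). tree_exp f n I x)"
    using Suc.prems finite_children by (intro member_le_sum) auto
  finally show ?case by simp
qed

text \<open>Differentiation concerns sequences that start at the root, so a branch beginning at
  \<open>J\<close> has to be extended upwards.\<close>

lemma ancestors:
  assumes "J \<in> generation (space M) C k" "x \<in> J"
  shows "\<exists>s. (\<forall>m\<le>k. s m \<in> generation (space M) C m \<and> x \<in> s m) \<and> s k = J"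
  using assms
proof (induction k arbitrary: J)
  case 0
  then show ?case by (intro exI[of _ "\<lambda>_. J"]) auto
next
  case (Suc k)
  then obtain L where L: "L \<in> generation (space M) C k" "J \<in> C L" by auto
  then have "L \<in> T" using generations by auto
  then have "x \<in> L" using children_Union[of L] L Suc.prems by blast
  then obtain s where "\<forall>m\<le>k. s m \<in> generation (space M) C m \<and> x \<in> s m" "s k = L"
    using Suc.IH L by blast
  then show ?case using Suc.prems
    by (intro exI[of _ "s(Suc k := J)"]) (auto simp: le_Suc_eq)
qed

lemma descendants:
  assumes "J \<in> T" "x \<in> J"
  obtains s where "s 0 = J" "\<And>n. s n \<in> T" "\<And>n. s (Suc n) \<in> C (s n)" "\<And>n. x \<in> s n"
proof -
  have "\<exists>s. \<forall>n. (s n \<in> T \<and> x \<in> s n \<and> (n = 0 \<longrightarrow> s n = J)) \<and> s (Suc n) \<in> C (s n)"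
  proof (rule dependent_nat_choice)
    show "\<exists>L. L \<in> T \<and> x \<in> L \<and> (0 = (0::nat) \<longrightarrow> L = J)" using assms by auto
    fix L and n :: nat assume L: "L \<in> T \<and> x \<in> L \<and> (n = 0 \<longrightarrow> L = J)"
    then obtain I where "I \<in> C L" "x \<in> I" using children_Union[of L] by blast
    then show "\<exists>I. (I \<in> T \<and> x \<in> I \<and> (Suc n = 0 \<longrightarrow> I = J)) \<and> I \<in> C L"
      using L children_sub by blast
  qed
  then show ?thesis using that by metis
qed

text \<open>Ancestors of \<open>J\<close> up to its generation \<open>k\<close>, followed by
  descendants containing \<open>x\<close>, form a full branch. The averages along it converge to
  \<open>f x\<close>, and \<open>tree_exp\<close> dominates their exponentials.\<close>

lemma liminf_tree_exp:
  assumes "J \<in> T" "x \<in> J"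
    and conv: "\<And>s. \<lbrakk>\<And>m. s m \<in> generation (space M) C m; \<And>m. x \<in> s m\<rbrakk> \<Longrightarrow>
      (\<lambda>m. avg M (s m) f) \<longlonglongrightarrow> f x"
  shows "ennreal (exp (f x)) \<le> liminf (\<lambda>n. tree_exp f n J x)"
proof -
  obtain k where k: "J \<in> generation (space M) C k" using assms generations by auto
  obtain a where a: "\<And>m. m \<le> k \<Longrightarrow> a m \<in> generation (space M) C m" "\<And>m. m \<le> k \<Longrightarrow> x \<in> a m" "a k = J"
    using ancestors[OF k assms(2)] by blast
  obtain s where s: "s 0 = J" "\<And>n. s n \<in> T" "\<And>n. s (Suc n) \<in> C (s n)" "\<And>n. x \<in> s n"
    using descendants[OF assms(1,2)] by blast
  have gen: "s n \<in> generation (space M) C (n + k)" for n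
    by (induction n) (use s k in auto)
  define c where "c = (\<lambda>m. if m < k then a m else s (m - k))"
  have "(\<lambda>m. avg M (c m) f) \<longlonglongrightarrow> f x"
  proof (rule conv)
    show "c m \<in> generation (space M) C m" for m
      using a(1)[of m] gen[of "m - k"] by (auto simp: c_def)
    show "x \<in> c m" for m using a(2)[of m] s(4) by (auto simp: c_def)
  qed
  then have "(\<lambda>n. avg M (c (n + k)) f) \<longlonglongrightarrow> f x" by (rule LIMSEQ_ignore_initial_segment)
  then have "(\<lambda>n. avg M (s n) f) \<longlonglongrightarrow> f x" by (simp add: c_def)
  then have "(\<lambda>n. ennreal (exp (avg M (s n) f))) \<longlonglongrightarrow> ennreal (exp (f x))"
    by (intro tendsto_intros)
  then have "ennreal (exp (f x)) = liminf (\<lambda>n. ennreal (exp (avg M (s n) f)))"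
    by (intro lim_imp_Liminf[symmetric]) auto
  also have "\<dots> \<le> liminf (\<lambda>n. tree_exp f n J x)"
    using tree_exp_chain[of s x _ f] s by (intro Liminf_mono) auto
  finally show ?thesis .
qed

text \<open>Induction on the depth: \<open>bell_ge\<close> starts it, and
  \<open>bell_finite_mixture\<close> passes from the children to \<open>J\<close>.\<close>

lemma nn_integral_tree_exp_le:
  assumes "bellman \<alpha> \<epsilon> \<delta> \<rho>"
    and f: "integrable M f" "integrable M (\<lambda>x. (f x)\<^sup>2)"
    and var: "\<And>J. J \<in> T \<Longrightarrow> variance_on f J \<le> \<epsilon>\<^sup>2"
    and J: "J \<in> T"
  shows "(\<integral>\<^sup>+x. tree_exp f n J x \<partial>M) \<le>
    ennreal (measure M J * bellman.bell \<delta> (avg M J f) (variance_on f J))"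
  using J
proof (induction n arbitrary: J)
  case 0
  interpret bellman \<alpha> \<epsilon> \<delta> \<rho> by fact
  have "J \<in> sets M" using 0 tree_sets by auto
  then have "(\<integral>\<^sup>+x. tree_exp f 0 J x \<partial>M) = ennreal (exp (avg M J f) * measure M J)"
    by (simp add: nn_integral_cmult_indicator emeasure_eq_measure ennreal_mult)
  also have "\<dots> = ennreal (measure M J * exp (avg M J f))" by (simp add: mult.commute)
  also have "\<dots> \<le> ennreal (measure M J * bell (avg M J f) (variance_on f J))"
    using bell_ge variance_on_nonneg[OF 0 f] var[OF 0] by (intro ennreal_leI mult_left_mono) auto
  finally show ?case .
next
  case (Suc n)
  interpret bellman \<alpha> \<epsilon> \<delta> \<rho> by fact
  have sub: "I \<in> T" if "I \<in> C J" for I using children_sub Suc.prems that by auto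
  have nonneg: "0 \<le> measure M I * bell (avg M I f) (variance_on f I)" if "I \<in> T" for I
    using bell_ge[OF variance_on_nonneg[OF that f] var[OF that], of "avg M I f"]
    by (intro mult_nonneg_nonneg) (auto intro: order_trans[OF less_imp_le[OF exp_gt_zero]])
  have "(\<integral>\<^sup>+x. tree_exp f (Suc n) J x \<partial>M) = (\<Sum>I\<in>C J. \<integral>\<^sup>+x. tree_exp f n I x \<partial>M)"
    using sub tree_exp_measurable by (simp add: nn_integral_sum)
  also have "\<dots> \<le> (\<Sum>I\<in>C J. ennreal (measure M I * bell (avg M I f) (variance_on f I)))"
    using Suc.IH sub by (intro sum_mono) auto
  also have "\<dots> = ennreal (\<Sum>I\<in>C J. measure M I * bell (avg M I f) (variance_on f I))"
    using nonneg sub by (intro sum_ennreal) auto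
  also have "\<dots> \<le> ennreal (measure M J * bell (avg M J f) (variance_on f J))"
  proof (rule ennreal_leI)
    have "(\<Sum>I\<in>C J. measure M I * bell (avg M I f) (variance_on f I)) \<le>
      sum (measure M) (C J) * bell (wmean (C J) (measure M) (\<lambda>I. avg M I f))
        (wvar (C J) (measure M) (\<lambda>I. avg M I f) (variance_on f))"
      using Suc.prems sub finite_children children_nonempty tree_pos children_ge var variance_on_nonneg[OF _ f]
      by (intro bell_finite_mixture) (auto simp: sum_measure_children variance_on_children[OF _ f, symmetric])
    then show "(\<Sum>I\<in>C J. measure M I * bell (avg M I f) (variance_on f I)) \<le>
        measure M J * bell (avg M J f) (variance_on f J)"
      using Suc.prems f by (simp add: sum_measure_children avg_children[symmetric] variance_on_children[symmetric])
  qed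
  finally show ?case .
qed

end

section \<open>Passage to the limit\<close>

theorem theorem1p6:
  fixes M :: "'a measure" and T :: "'a set set" and J :: "'a set"
    and \<phi> :: "'a \<Rightarrow> real" and \<alpha> \<epsilon> :: real
  assumes "0 < \<alpha>" and "\<alpha> \<le> 1 / 2"
    and "0 < \<epsilon>" and "\<epsilon> < eps0 \<alpha>"
    and "0 < emeasure M (space M)" and "emeasure M (space M) < \<infinity>"
    and "alpha_tree \<alpha> M T"
    and "J \<in> T"
    and "\<phi> \<in> BMO M T"
    and "bmo_norm M T \<phi> \<le> ereal \<epsilon>"
  shows "set_integrable M J (\<lambda>x. exp (\<phi> x)) \<and>
         avg M J (\<lambda>x. exp (\<phi> x)) \<le> K_const \<alpha> \<epsilon> * exp (avg M J \<phi>)"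
proof -
  interpret finite_measure M using assms(6) by (intro finite_measureI) auto
  obtain C where C: "\<forall>J\<in>T. C J \<subseteq> T \<and> J = \<Union>(C J) \<and>
                 (\<forall>I\<in>C J. \<forall>I'\<in>C J. I \<noteq> I' \<longrightarrow> emeasure M (I \<inter> I') = 0) \<and>
                 (\<forall>I\<in>C J. measure M I \<ge> \<alpha> * measure M J)"
    and gen: "T = (\<Union>m. generation (space M) C m)"
    and diff: "\<forall>f :: 'a \<Rightarrow> real. integrable M f \<longrightarrow>
             (AE x in M. \<forall>J. (\<forall>m. J m \<in> generation (space M) C m \<and> x \<in> J m) \<longrightarrow>
                (\<lambda>m. avg M (J m) f) \<longlonglongrightarrow> f x)"
    using assms(7) unfolding alpha_tree_def by (elim conjE exE) (rule that; assumption)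
  interpret finite_alpha_tree M \<alpha> T C
  proof
    show "0 < measure M (space M)"
      using assms(5) by (simp add: emeasure_eq_measure)
    show "T \<subseteq> sets M" using assms(7) unfolding alpha_tree_def by (rule conjunct1)
    fix J assume J: "J \<in> T"
    note CJ = bspec[OF C J]
    show "C J \<subseteq> T" using CJ by (rule conjunct1)
    show "J = \<Union> (C J)" using CJ by (elim conjE)
    fix I assume I: "I \<in> C J"
    show "\<alpha> * measure M J \<le> measure M I" using CJ I by (elim conjE) (rule bspec)
    show "emeasure M (I \<inter> I') = 0" if "I' \<in> C J" "I \<noteq> I'" for I'
      using CJ[THEN conjunct2, THEN conjunct2, THEN conjunct1] I that by blast
  qed (fact assms(1), fact gen)
  have "\<phi> \<in> borel_measurable M" and sq: "integrable M (\<lambda>x. (\<phi> x)\<^sup>2)"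
    using assms(9) by (auto simp: BMO_def)
  note [measurable] = \<open>\<phi> \<in> borel_measurable M\<close>
  have \<phi>: "integrable M \<phi>" by (rule square_integrable_imp_integrable) (use sq in auto)
  have var: "variance_on \<phi> I \<le> \<epsilon>\<^sup>2" if "I \<in> T" for I
  proof -
    have "ereal (sqrt (variance_on \<phi> I)) \<le> bmo_norm M T \<phi>"
      unfolding bmo_norm_def variance_on_def using that by (rule SUP_upper)
    also have "\<dots> \<le> ereal \<epsilon>" by (rule assms(10))
    finally have "sqrt (variance_on \<phi> I) \<le> \<epsilon>" by simp
    then show ?thesis by (rule sqrt_le_D)
  qed
  obtain \<delta> \<rho> where B: "bellman \<alpha> \<epsilon> \<delta> \<rho>"
    using bellman_exists[of \<alpha> \<epsilon>] assms(1-4) by auto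
  interpret bellman \<alpha> \<epsilon> \<delta> \<rho> by (rule B)
  define b where "b = bell (avg M J \<phi>) (variance_on \<phi> J)"
  have J: "J \<in> sets M" "0 < measure M J" using assms(8) tree_sets tree_pos by auto
  note [measurable] = J(1)
  have "AE x in M. ennreal (indicator J x * exp (\<phi> x)) \<le> liminf (\<lambda>n. tree_exp \<phi> n J x)"
    using diff[rule_format, OF \<phi>]
  proof eventually_elim
    case (elim x)
    then show ?case using liminf_tree_exp[OF assms(8), of x \<phi>] by (cases "x \<in> J") auto
  qed
  then have "(\<integral>\<^sup>+x. ennreal (indicator J x * exp (\<phi> x)) \<partial>M) \<le> (\<integral>\<^sup>+x. liminf (\<lambda>n. tree_exp \<phi> n J x) \<partial>M)"
    by (rule nn_integral_mono_AE)
  \<comment> \<open>Fatou's lemma; the bound that follows is the same for every generation.\<close>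
  also have "\<dots> \<le> liminf (\<lambda>n. \<integral>\<^sup>+x. tree_exp \<phi> n J x \<partial>M)"
    by (intro nn_integral_liminf tree_exp_measurable assms(8))
  also have "\<dots> \<le> liminf (\<lambda>n::nat. ennreal (measure M J * b))"
    using nn_integral_tree_exp_le[OF B \<phi> sq var assms(8)] unfolding b_def
    by (intro Liminf_mono always_eventually allI)
  also have "\<dots> = ennreal (measure M J * b)" by (simp add: Liminf_const)
  finally have le: "(\<integral>\<^sup>+x. ennreal (indicator J x * exp (\<phi> x)) \<partial>M) \<le> ennreal (measure M J * b)" .
  \<comment> \<open>Integrability of the exponential is itself a conclusion, drawn from the finite
    bound on its nonnegative integral.\<close>
  have int: "integrable M (\<lambda>x. indicator J x * exp (\<phi> x))"
    using le by (intro integrableI_nonneg) (auto simp: top_unique less_top[symmetric])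
  have "0 \<le> b"
    using bell_ge[OF variance_on_nonneg[OF assms(8) \<phi> sq] var[OF assms(8)], of "avg M J \<phi>"]
    unfolding b_def by (meson exp_ge_zero order_trans)
  have "(\<integral>x. indicator J x * exp (\<phi> x) \<partial>M) \<le> measure M J * b"
    using le \<open>0 \<le> b\<close> unfolding nn_integral_eq_integral[OF int, simplified] by simp
  then have "avg M J (\<lambda>x. exp (\<phi> x)) \<le> b"
    using J by (simp add: avg_def set_lebesgue_integral_def field_simps)
  also have "b \<le> K_const \<alpha> \<epsilon> * exp (avg M J \<phi>)"
    unfolding b_def using var[OF assms(8)] by (rule bell_le)
  finally show ?thesis using int by (simp add: set_integrable_def)
qed

end
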